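(* Let $E$ be an arbitrary directed graph, $K$ a field, and $p$ an infinite path in $E$. Then: (1) If $p$ does not end in an exclusive cycle, then the annihilator in $L_K(E)$ of $V_{[p]}$ is $I(H(p),B_{H(p)})$. (2) If $p$ ends in an exclusive cycle $c$ based at a vertex $v$, then the annihilator in $L_K(E)$ of $V_{[p]}$ is $I(H(p),B_{H(p)},(c-v))$, the two-sided ideal generated by $I(H(p),B_{H(p)})$ and $c-v$.
   Context: A directed graph $E=(E^0,E^1,r,s)$ consists of sets $E^0$ (vertices), $E^1$ (edges), of any cardinality, and maps $r,s:E^1\to E^0$. A vertex $v$ is regular if $s^{-1}(v)$ is finite and non-empty, an infinite emitter if $s^{-1}(v)$ is infinite. Vertices are paths of length $0$; $u\ge v$ means there is a path from $u$ to $v$. A cycle based at $v$ is a path $e_1\cdots e_n$ ($n\ge1$) with $s(e_1)=r(e_n)=v$ and $s(e_i)\ne s(e_j)$ for $i\neq j$; cycles are considered up to rotation. A cycle $c$ is exclusive if no vertex on $c$ is the base of a cycle other than the rotate of $c$ based at that vertex. $L_K(E)$ (Leavitt path algebra) is the $K$-algebra generated by pairwise orthogonal idempotents $v\in E^0$ and elements $e,e^*$ ($e\in E^1$) with relations: $s(e)e=e=er(e)$; $r(e)e^*=e^*=e^*s(e)$; $e^*e=r(e)$ and $e^*f=0$ for $e\ne f$; $v=\sum_{s(e)=v}ee^*$ for every regular vertex $v$. For an infinite path $p=e_1e_2\cdots$ put $\tau_{>n}(p)=e_{n+1}e_{n+2}\cdots$. Infinite paths $p,q$ are tail-equivalent if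 $\tau_{>m}(p)=\tau_{>n}(q)$ for some positive integers $m,n$; $[p]$ is the class of $p$. $p$ ends in a cycle $c$ if $p$ is tail-equivalent to $c^\infty=ccc\cdots$. $H(p)=E^0\setminus\{w\in E^0: w\ge u\text{ for some vertex }u\text{ on }p\}$, a hereditary saturated set (hereditary: $u\in H,u\ge u'$ imply $u'\in H$; saturated: a regular $u$ with $r(s^{-1}(u))\subseteq H$ lies in $H$). For a hereditary saturated $H$, $B_H$ is the set of infinite emitters $u\in E^0\setminus H$ with $1\le|s^{-1}(u)\cap r^{-1}(E^0\setminus H)|<\infty$; for $u\in B_H$, $u^H=u-\sum_{s(e)=u,\,r(e)\notin H}ee^*$; for $S\subseteq B_H$, $I(H,S)$ is the two-sided ideal of $L_K(E)$ generated by $H\cup\{u^H:u\in S\}$. $V_{[p]}$ is the $K$-vector space with basis $[p]$, with left $L_K(E)$-action on $q\in[p]$: $v\cdot q=q$ if $v=s(q)$, else $0$; $e\cdot q=eq$ if $r(e)=s(q)$, else $0$; $e^*\cdot q=\tau_{>1}(q)$ if $q=eq'$, else $0$. It is a simple module. *)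

theory Defs
  imports
    "HOL-Library.Poly_Mapping"
    "HOL-Library.Stream"
    "Graph_Theory.Arc_Walk"
begin

(* A directed graph is a well-formed pre_digraph E: E^0 = verts E, E^1 = arcs E (of any
   cardinality, parallel edges and loops allowed), s = tail E, r = head E. A finite path from u
   to v is an awalk, and u >= v is reachability in E. *)

section \<open>Algebras without unit\<close>

record ('a, 'k) nonunital_algebra =
  acarrier :: "'a set"
  aadd :: "'a \<Rightarrow> 'a \<Rightarrow> 'a"
  azero :: 'a
  amult :: "'a \<Rightarrow> 'a \<Rightarrow> 'a"
  ascale :: "'k \<Rightarrow> 'a \<Rightarrow> 'a"

definition is_ideal :: "('a, 'k) nonunital_algebra \<Rightarrow> 'a set \<Rightarrow> bool" where
  "is_ideal A I \<longleftrightarrow>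
     I \<subseteq> acarrier A \<and> azero A \<in> I \<and>
     (\<forall>x\<in>I. \<forall>y\<in>I. aadd A x y \<in> I) \<and>
     (\<forall>k. \<forall>x\<in>I. ascale A k x \<in> I) \<and>
     (\<forall>a\<in>acarrier A. \<forall>x\<in>I. amult A a x \<in> I \<and> amult A x a \<in> I)"

definition ideal_gen :: "('a, 'k) nonunital_algebra \<Rightarrow> 'a set \<Rightarrow> 'a set" where
  "ideal_gen A S = \<Inter>{I. is_ideal A I \<and> S \<subseteq> I}"

definition coset :: "('a, 'k) nonunital_algebra \<Rightarrow> 'a set \<Rightarrow> 'a \<Rightarrow> 'a set" where
  "coset A I x = {aadd A x y |y. y \<in> I}"

(* For an ideal I the unions below range over sets that are all equal to each other, the coset of
   the sum, product or multiple of arbitrary representatives. *)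
definition quotient_algebra ::
    "('a, 'k) nonunital_algebra \<Rightarrow> 'a set \<Rightarrow> ('a set, 'k) nonunital_algebra" where
  "quotient_algebra A I =
     \<lparr>acarrier = coset A I ` acarrier A,
      aadd = (\<lambda>X Y. \<Union>x\<in>X. \<Union>y\<in>Y. coset A I (aadd A x y)),
      azero = coset A I (azero A),
      amult = (\<lambda>X Y. \<Union>x\<in>X. \<Union>y\<in>Y. coset A I (amult A x y)),
      ascale = (\<lambda>k X. \<Union>x\<in>X. coset A I (ascale A k x))\<rparr>"

definition annihilator ::
    "('a, 'k) nonunital_algebra \<Rightarrow> ('a \<Rightarrow> 'm \<Rightarrow> 'm::zero) \<Rightarrow> 'm set \<Rightarrow> 'a set" where
  "annihilator A act M = {a \<in> acarrier A. \<forall>m\<in>M. act a m = 0}"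


section \<open>Leavitt path algebras\<close>

(* Lists under concatenation form the free monoid, so that 'g list =>0 'k carries the
   multiplication of the free associative algebra on 'g. *)
instantiation list :: (type) monoid_add
begin
definition zero_list :: "'a list" where "zero_list = []"
definition plus_list :: "'a list \<Rightarrow> 'a list \<Rightarrow> 'a list" where "plus_list = (@)"
instance by standard (simp_all add: zero_list_def plus_list_def)
end

datatype ('v, 'e) generator = Vertex 'v | Edge 'e | Ghost 'e

type_synonym ('v, 'e, 'k) free_elem = "('v, 'e) generator list \<Rightarrow>\<^sub>0 'k"

definition generators :: "('v, 'e) pre_digraph \<Rightarrow> ('v, 'e) generator set" where
  "generators E = Vertex ` verts E \<union> Edge ` arcs E \<union> Ghost ` arcs E"

abbreviation gen :: "('v, 'e) generator \<Rightarrow> ('v, 'e, 'k::field) free_elem" where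
  "gen g \<equiv> Poly_Mapping.single [g] 1"

abbreviation vx :: "'v \<Rightarrow> ('v, 'e, 'k::field) free_elem" where "vx v \<equiv> gen (Vertex v)"
abbreviation ed :: "'e \<Rightarrow> ('v, 'e, 'k::field) free_elem" where "ed e \<equiv> gen (Edge e)"
abbreviation gh :: "'e \<Rightarrow> ('v, 'e, 'k::field) free_elem" where "gh e \<equiv> gen (Ghost e)"

abbreviation scale :: "'k::field \<Rightarrow> ('a \<Rightarrow>\<^sub>0 'k) \<Rightarrow> ('a \<Rightarrow>\<^sub>0 'k)" where
  "scale k \<equiv> Poly_Mapping.map ((*) k)"

(* The free algebra without unit: only nonempty words occur. (With infinitely many vertices the
   Leavitt path algebra has no unit, and with finitely many its unit is the sum of the vertices,
   which the relations do not force to agree with the empty word.) *)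
definition free_algebra ::
    "('v, 'e) pre_digraph \<Rightarrow> (('v, 'e, 'k::field) free_elem, 'k) nonunital_algebra" where
  "free_algebra E =
     \<lparr>acarrier = {x. \<forall>w\<in>Poly_Mapping.keys x. w \<noteq> [] \<and> set w \<subseteq> generators E},
      aadd = (+), azero = 0, amult = (*), ascale = scale\<rparr>"

definition regular :: "('v, 'e) pre_digraph \<Rightarrow> 'v \<Rightarrow> bool" where
  "regular E v \<longleftrightarrow> v \<in> verts E \<and> finite (out_arcs E v) \<and> out_arcs E v \<noteq> {}"

definition infinite_emitter :: "('v, 'e) pre_digraph \<Rightarrow> 'v \<Rightarrow> bool" where
  "infinite_emitter E v \<longleftrightarrow> v \<in> verts E \<and> infinite (out_arcs E v)"

inductive_set relators :: "('v, 'e) pre_digraph \<Rightarrow> ('v, 'e, 'k::field) free_elem set"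
  for E :: "('v, 'e) pre_digraph" where
  "v \<in> verts E \<Longrightarrow> vx v * vx v - vx v \<in> relators E"
| "u \<in> verts E \<Longrightarrow> v \<in> verts E \<Longrightarrow> u \<noteq> v \<Longrightarrow> vx u * vx v \<in> relators E"
| "e \<in> arcs E \<Longrightarrow> vx (tail E e) * ed e - ed e \<in> relators E"
| "e \<in> arcs E \<Longrightarrow> ed e * vx (head E e) - ed e \<in> relators E"
| "e \<in> arcs E \<Longrightarrow> vx (head E e) * gh e - gh e \<in> relators E"
| "e \<in> arcs E \<Longrightarrow> gh e * vx (tail E e) - gh e \<in> relators E"
| "e \<in> arcs E \<Longrightarrow> gh e * ed e - vx (head E e) \<in> relators E"
| "e \<in> arcs E \<Longrightarrow> f \<in> arcs E \<Longrightarrow> e \<noteq> f \<Longrightarrow> gh e * ed f \<in> relators E"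
| "regular E v \<Longrightarrow> vx v - (\<Sum>e\<in>out_arcs E v. ed e * gh e) \<in> relators E"

definition relation_ideal :: "('v, 'e) pre_digraph \<Rightarrow> ('v, 'e, 'k::field) free_elem set" where
  "relation_ideal E = ideal_gen (free_algebra E) (relators E)"

type_synonym ('v, 'e, 'k) lpa_elem = "('v, 'e, 'k) free_elem set"

definition lpa :: "('v, 'e) pre_digraph \<Rightarrow> (('v, 'e, 'k::field) lpa_elem, 'k) nonunital_algebra"
  where "lpa E = quotient_algebra (free_algebra E) (relation_ideal E)"

definition lpa_class ::
    "('v, 'e) pre_digraph \<Rightarrow> ('v, 'e, 'k::field) free_elem \<Rightarrow> ('v, 'e, 'k) lpa_elem" where
  "lpa_class E = coset (free_algebra E) (relation_ideal E)"


section \<open>The ideals I(H,S)\<close>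

definition breaking_vertices :: "('v, 'e) pre_digraph \<Rightarrow> 'v set \<Rightarrow> 'v set" where
  "breaking_vertices E H =
     {u \<in> verts E - H. infinite_emitter E u \<and>
        finite {e \<in> out_arcs E u. head E e \<notin> H} \<and> {e \<in> out_arcs E u. head E e \<notin> H} \<noteq> {}}"

definition breaking_elem ::
    "('v, 'e) pre_digraph \<Rightarrow> 'v set \<Rightarrow> 'v \<Rightarrow> ('v, 'e, 'k::field) free_elem" where
  "breaking_elem E H u = vx u - (\<Sum>e | e \<in> out_arcs E u \<and> head E e \<notin> H. ed e * gh e)"

definition ideal_HS ::
    "('v, 'e) pre_digraph \<Rightarrow> 'v set \<Rightarrow> 'v set \<Rightarrow> ('v, 'e, 'k::field) lpa_elem set" where
  "ideal_HS E H S =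
     ideal_gen (lpa E) ((\<lambda>v. lpa_class E (vx v)) ` H \<union> (\<lambda>u. lpa_class E (breaking_elem E H u)) ` S)"


section \<open>Cycles and infinite paths\<close>

definition cycle_at :: "('v, 'e) pre_digraph \<Rightarrow> 'v \<Rightarrow> 'e list \<Rightarrow> bool" where
  "cycle_at E v c \<longleftrightarrow> pre_digraph.awalk E v c v \<and> c \<noteq> [] \<and> distinct (map (tail E) c)"

definition exclusive_cycle_at :: "('v, 'e) pre_digraph \<Rightarrow> 'v \<Rightarrow> 'e list \<Rightarrow> bool" where
  "exclusive_cycle_at E v c \<longleftrightarrow>
     cycle_at E v c \<and>
     (\<forall>w\<in>tail E ` set c. \<forall>d. cycle_at E w d \<longrightarrow> (\<exists>n. d = rotate n c))"

definition infinite_path :: "('v, 'e) pre_digraph \<Rightarrow> 'e stream \<Rightarrow> bool" where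
  "infinite_path E p \<longleftrightarrow>
     (\<forall>n. p !! n \<in> arcs E \<and> head E (p !! n) = tail E (p !! Suc n))"

definition tail_equivalent :: "'e stream \<Rightarrow> 'e stream \<Rightarrow> bool" where
  "tail_equivalent p q \<longleftrightarrow> (\<exists>m>0. \<exists>n>0. sdrop m p = sdrop n q)"

definition tail_class :: "('v, 'e) pre_digraph \<Rightarrow> 'e stream \<Rightarrow> 'e stream set" where
  "tail_class E p = {q. infinite_path E q \<and> tail_equivalent p q}"

(* Stream.cycle c is the periodic stream c c c ... *)
definition ends_in_cycle :: "'e stream \<Rightarrow> 'e list \<Rightarrow> bool" where
  "ends_in_cycle p c \<longleftrightarrow> tail_equivalent p (Stream.cycle c)"

definition path_H :: "('v, 'e) pre_digraph \<Rightarrow> 'e stream \<Rightarrow> 'v set" where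
  "path_H E p = verts E - {w \<in> verts E. \<exists>u\<in>tail E ` sset p. reachable E w u}"

definition cycle_minus_vertex :: "'v \<Rightarrow> 'e list \<Rightarrow> ('v, 'e, 'k::field) free_elem" where
  "cycle_minus_vertex v c = prod_list (map ed c) - vx v"


section \<open>The module of a tail-equivalence class\<close>

type_synonym ('e, 'k) path_vec = "'e stream \<Rightarrow>\<^sub>0 'k"

definition chen_module :: "('v, 'e) pre_digraph \<Rightarrow> 'e stream \<Rightarrow> ('e, 'k::field) path_vec set" where
  "chen_module E p = {m. Poly_Mapping.keys m \<subseteq> tail_class E p}"

fun basis_action ::
    "('v, 'e) pre_digraph \<Rightarrow> ('v, 'e) generator \<Rightarrow> 'e stream \<Rightarrow> ('e, 'k::field) path_vec" where
  "basis_action E (Vertex v) q = (if v = tail E (shd q) then Poly_Mapping.single q 1 else 0)"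
| "basis_action E (Edge e) q =
     (if head E e = tail E (shd q) then Poly_Mapping.single (e ## q) 1 else 0)"
| "basis_action E (Ghost e) q = (if shd q = e then Poly_Mapping.single (stl q) 1 else 0)"

definition linear_extension ::
    "('a \<Rightarrow> ('b \<Rightarrow>\<^sub>0 'k::field)) \<Rightarrow> ('a \<Rightarrow>\<^sub>0 'k) \<Rightarrow> ('b \<Rightarrow>\<^sub>0 'k)" where
  "linear_extension f x = (\<Sum>b\<in>Poly_Mapping.keys x. scale (Poly_Mapping.lookup x b) (f b))"

definition word_action ::
    "('v, 'e) pre_digraph \<Rightarrow> ('v, 'e) generator list \<Rightarrow>
     ('e, 'k::field) path_vec \<Rightarrow> ('e, 'k) path_vec" where
  "word_action E w m = foldr (\<lambda>g. linear_extension (basis_action E g)) w m"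

definition free_action ::
    "('v, 'e) pre_digraph \<Rightarrow> ('v, 'e, 'k::field) free_elem \<Rightarrow>
     ('e, 'k) path_vec \<Rightarrow> ('e, 'k) path_vec" where
  "free_action E x m = linear_extension (\<lambda>w. word_action E w m) x"

(* The common value on all representatives of the coset a; see lpa_action_class below. *)
definition lpa_action ::
    "('v, 'e) pre_digraph \<Rightarrow> ('v, 'e, 'k::field) lpa_elem \<Rightarrow>
     ('e, 'k) path_vec \<Rightarrow> ('e, 'k) path_vec" where
  "lpa_action E a m = the_elem ((\<lambda>x. free_action E x m) ` a)"


section \<open>The operations of the Leavitt path algebra on representatives\<close>

lemma lookup_scale [simp]:
  "Poly_Mapping.lookup (scale k x) b = (k::'k::field) * Poly_Mapping.lookup x b"
  by transfer (simp add: when_def)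

lemma scale_add: "scale k (x + y) = scale k x + scale k y"
  by (rule poly_mapping_eqI) (simp add: lookup_add algebra_simps)
lemma scale_add_left: "scale (k + l) x = scale k x + scale l x"
  by (rule poly_mapping_eqI) (simp add: lookup_add algebra_simps)
lemma scale_scale: "scale k (scale l x) = scale (k * l) x"
  by (rule poly_mapping_eqI) (simp add: algebra_simps)
lemma scale_simps [simp]:
  "scale 0 x = 0" "scale 1 x = x" "scale k 0 = 0" "scale k (- x) = - scale k x"
  by (rule poly_mapping_eqI, simp)+
lemma scale_sum: "scale k (\<Sum>a\<in>A. f a) = (\<Sum>a\<in>A. scale k (f a))"
  by (induction A rule: infinite_finite_induct) (simp_all add: scale_add)
lemma scale_single [simp]: "scale k (Poly_Mapping.single b l) = Poly_Mapping.single b (k * l)"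
  by (rule poly_mapping_eqI) (simp add: lookup_single when_def)
lemma keys_scale: "Poly_Mapping.keys (scale k x) \<subseteq> Poly_Mapping.keys x"
  by (auto simp: in_keys_iff)

lemma poly_mapping_expand:
  "x = (\<Sum>b\<in>Poly_Mapping.keys x. Poly_Mapping.single b (Poly_Mapping.lookup x b))"
  by (rule poly_mapping_eqI)
     (auto simp: lookup_sum lookup_single when_def in_keys_iff sum.delta)

lemma le_superset:
  assumes "finite A" "Poly_Mapping.keys x \<subseteq> A"
  shows "linear_extension f x = (\<Sum>b\<in>A. scale (Poly_Mapping.lookup x b) (f b))"
  unfolding linear_extension_def
  by (rule sum.mono_neutral_left) (use assms in \<open>auto simp: in_keys_iff\<close>)

lemma le_add: "linear_extension f (x + y) = linear_extension f x + linear_extension f y"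
proof -
  let ?A = "Poly_Mapping.keys x \<union> Poly_Mapping.keys y"
  have "Poly_Mapping.keys (x + y) \<subseteq> ?A" by (rule keys_add)
  then show ?thesis
    by (simp add: le_superset[of ?A] lookup_add scale_add_left sum.distrib)
qed

lemma le_scale: "linear_extension f (scale k x) = scale k (linear_extension f x)"
  using keys_scale[of k x]
  by (simp add: le_superset[of "Poly_Mapping.keys x"] scale_sum scale_scale)

lemma le_zero [simp]: "linear_extension f 0 = 0"
  by (simp add: linear_extension_def)

lemma le_sum: "linear_extension f (\<Sum>a\<in>A. x a) = (\<Sum>a\<in>A. linear_extension f (x a))"
  by (induction A rule: infinite_finite_induct) (simp_all add: le_add)

lemma le_uminus: "linear_extension f (- x) = - linear_extension f x"
  by (metis add_eq_0_iff le_add le_zero)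

lemma le_diff: "linear_extension f (x - y) = linear_extension f x - linear_extension f y"
  by (metis add_diff_cancel_right' diff_add_cancel le_add)

lemma le_single [simp]: "linear_extension f (Poly_Mapping.single b k) = scale k (f b)"
  by (simp add: linear_extension_def)

lemma wa_simps [simp]: "word_action E [] m = m"
  "word_action E (g # w) m = linear_extension (basis_action E g) (word_action E w m)"
  by (simp_all add: word_action_def)

lemma wa_append: "word_action E (w @ w') m = word_action E w (word_action E w' m)"
  by (simp add: word_action_def)

lemma wa_add: "word_action E w (m + m') = word_action E w m + word_action E w m'"
  by (induction w) (simp_all add: le_add)
lemma wa_scale: "word_action E w (scale k m) = scale k (word_action E w m)"
  by (induction w) (simp_all add: le_scale)
lemma wa_zero [simp]: "word_action E w 0 = 0"
  by (induction w) simp_all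
lemma wa_sum: "word_action E w (\<Sum>a\<in>A. m a) = (\<Sum>a\<in>A. word_action E w (m a))"
  by (induction A rule: infinite_finite_induct) (simp_all add: wa_add)

lemma fa_add: "free_action E (x + y) m = free_action E x m + free_action E y m"
  by (simp add: free_action_def le_add)
lemma fa_diff: "free_action E (x - y) m = free_action E x m - free_action E y m"
  by (simp add: free_action_def le_diff)
lemma fa_sum_left: "free_action E (\<Sum>a\<in>A. x a) m = (\<Sum>a\<in>A. free_action E (x a) m)"
  by (simp add: free_action_def le_sum)
lemma fa_scale: "free_action E (scale k x) m = scale k (free_action E x m)"
  by (simp add: free_action_def le_scale)
lemma fa_zero [simp]: "free_action E x 0 = 0" "free_action E 0 m = 0"
  by (simp_all add: free_action_def linear_extension_def)
lemma fa_add_right: "free_action E x (m + m') = free_action E x m + free_action E x m'"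
  by (simp add: free_action_def linear_extension_def wa_add scale_add sum.distrib)
lemma fa_scale_right: "free_action E x (scale k m) = scale k (free_action E x m)"
  by (simp add: free_action_def linear_extension_def wa_scale scale_sum scale_scale mult.commute)
lemma fa_sum_right: "free_action E x (\<Sum>a\<in>A. m a) = (\<Sum>a\<in>A. free_action E x (m a))"
  by (induction A rule: infinite_finite_induct) (simp_all add: fa_add_right)
lemma fa_single [simp]: "free_action E (Poly_Mapping.single w k) m = scale k (word_action E w m)"
  by (simp add: free_action_def)

lemma fa_mult: "free_action E (x * y) m = free_action E x (free_action E y m)"
proof -
  let ?s = "\<lambda>x b. Poly_Mapping.single b (Poly_Mapping.lookup x b)"
  have 1: "free_action E (?s x w * ?s y w') m = free_action E (?s x w) (free_action E (?s y w') m)" for w w'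
    by (simp add: mult_single plus_list_def wa_append wa_scale scale_scale)
  have "x * y = (\<Sum>w\<in>Poly_Mapping.keys x. ?s x w) * (\<Sum>w\<in>Poly_Mapping.keys y. ?s y w)"
    by (subst (1) poly_mapping_expand[of x], subst (1) poly_mapping_expand[of y], rule refl)
  then have "free_action E (x * y) m =
      (\<Sum>w\<in>Poly_Mapping.keys x. \<Sum>w'\<in>Poly_Mapping.keys y. free_action E (?s x w) (free_action E (?s y w') m))"
    by (simp only: sum_product fa_sum_left 1)
  also have "\<dots> = free_action E (\<Sum>w\<in>Poly_Mapping.keys x. ?s x w)
      (free_action E (\<Sum>w\<in>Poly_Mapping.keys y. ?s y w) m)"
    by (simp only: fa_sum_left fa_sum_right) (rule sum.swap)
  also have "\<dots> = free_action E x (free_action E y m)"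
    by (simp only: poly_mapping_expand[symmetric])
  finally show ?thesis .
qed

lemma te_trans: 
  assumes "tail_equivalent p q" "sdrop m q = sdrop n q'" shows "tail_equivalent p q'"
proof -
  from assms obtain i j where ij: "i > 0" "j > 0" "sdrop i p = sdrop j q"
    by (auto simp: tail_equivalent_def)
  have "sdrop (i + m) p = sdrop (j + n) q'"
    using ij(3) assms(2) by (metis sdrop_add add.commute)
  with ij show ?thesis unfolding tail_equivalent_def by (metis add_gr_0)
qed

lemma ip_SCons: "infinite_path E (e ## q) \<longleftrightarrow> e \<in> arcs E \<and> head E e = tail E (shd q) \<and> infinite_path E q"
  (is "?L = ?R")
proof
  assume L: ?L
  then have "(e ## q) !! n \<in> arcs E \<and> head E ((e ## q) !! n) = tail E ((e ## q) !! Suc n)" for n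
    by (simp only: infinite_path_def)
  from this[of 0] this[of "Suc _"] show ?R by (simp add: infinite_path_def)
next
  assume R: ?R
  show ?L unfolding infinite_path_def
  proof
    fix n show "(e ## q) !! n \<in> arcs E \<and> head E ((e ## q) !! n) = tail E ((e ## q) !! Suc n)"
      using R by (cases n) (auto simp: infinite_path_def)
  qed
qed

lemma tc_SCons:
  assumes "q \<in> tail_class E p" "e \<in> arcs E" "head E e = tail E (shd q)"
  shows "e ## q \<in> tail_class E p"
  using assms te_trans[of p q 0 1 "e ## q"] by (auto simp: tail_class_def ip_SCons)

lemma tc_stl:
  assumes "q \<in> tail_class E p" shows "stl q \<in> tail_class E p"
  using assms te_trans[of p q 1 0 "stl q"] ip_SCons[of E "shd q" "stl q"]
  by (auto simp: tail_class_def)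

lemma cm_zero: "0 \<in> chen_module E p" by (simp add: chen_module_def)
lemma cm_add: "m \<in> chen_module E p \<Longrightarrow> m' \<in> chen_module E p \<Longrightarrow> m + m' \<in> chen_module E p"
  using keys_add[of m m'] by (auto simp: chen_module_def)
lemma cm_scale: "m \<in> chen_module E p \<Longrightarrow> scale k m \<in> chen_module E p"
  using keys_scale[of k m] by (auto simp: chen_module_def)
lemma cm_sum: "(\<And>a. a \<in> A \<Longrightarrow> m a \<in> chen_module E p) \<Longrightarrow> (\<Sum>a\<in>A. m a) \<in> chen_module E p"
  by (induction A rule: infinite_finite_induct) (auto simp: cm_zero cm_add)
lemma cm_single: "q \<in> tail_class E p \<Longrightarrow> Poly_Mapping.single q k \<in> chen_module E p"
  by (simp add: chen_module_def)

lemma cm_le: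
  assumes "\<And>b. b \<in> Poly_Mapping.keys x \<Longrightarrow> f b \<in> chen_module E p"
  shows "linear_extension f x \<in> chen_module E p"
  unfolding linear_extension_def by (intro cm_sum cm_scale assms)

lemma cm_basis:
  assumes "g \<in> generators E" "q \<in> tail_class E p"
  shows "basis_action E g q \<in> chen_module E p"
  using assms by (cases g) (auto simp: cm_zero cm_single tc_SCons tc_stl generators_def)

lemma cm_word:
  assumes "m \<in> chen_module E p" "set w \<subseteq> generators E"
  shows "word_action E w m \<in> chen_module E p"
  using assms(2)
proof (induction w)
  case (Cons g w)
  then have "word_action E w m \<in> chen_module E p" by simp
  then have "b \<in> tail_class E p" if "b \<in> Poly_Mapping.keys (word_action E w m)" for b
    using that by (auto simp: chen_module_def)
  with Cons.prems show ?case by (auto intro!: cm_le cm_basis)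
qed (use assms in simp)

lemma cm_free:
  assumes "m \<in> chen_module E p" "x \<in> acarrier (free_algebra E)"
  shows "free_action E x m \<in> chen_module E p"
  unfolding free_action_def
  by (rule cm_le, rule cm_word) (use assms in \<open>auto simp: free_algebra_def\<close>)


lemma fc_zero: "0 \<in> acarrier (free_algebra E)" by (simp add: free_algebra_def)
lemma fc_add: "x \<in> acarrier (free_algebra E) \<Longrightarrow> y \<in> acarrier (free_algebra E) \<Longrightarrow>
    x + y \<in> acarrier (free_algebra E)"
  using keys_add[of x y] by (fastforce simp: free_algebra_def)
lemma fc_diff: "x \<in> acarrier (free_algebra E) \<Longrightarrow> y \<in> acarrier (free_algebra E) \<Longrightarrow>
    x - y \<in> acarrier (free_algebra E)"
  using keys_diff[of x y] by (fastforce simp: free_algebra_def)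
lemma fc_scale: "x \<in> acarrier (free_algebra E) \<Longrightarrow> scale k x \<in> acarrier (free_algebra E)"
  using keys_scale[of k x] by (fastforce simp: free_algebra_def)
lemma fc_mult: "x \<in> acarrier (free_algebra E) \<Longrightarrow> y \<in> acarrier (free_algebra E) \<Longrightarrow>
    x * y \<in> acarrier (free_algebra E)"
  using keys_mult[of x y] by (fastforce simp: free_algebra_def plus_list_def)
lemma fc_sum: "(\<And>a. a \<in> A \<Longrightarrow> x a \<in> acarrier (free_algebra E)) \<Longrightarrow>
    (\<Sum>a\<in>A. x a) \<in> acarrier (free_algebra E)"
  by (induction A rule: infinite_finite_induct) (auto simp: fc_zero fc_add)
lemma fc_gen:
  "v \<in> verts E \<Longrightarrow> vx v \<in> acarrier (free_algebra E)"
  "e \<in> arcs E \<Longrightarrow> ed e \<in> acarrier (free_algebra E)"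
  "e \<in> arcs E \<Longrightarrow> gh e \<in> acarrier (free_algebra E)"
  by (auto simp: free_algebra_def generators_def)

lemma free_algebra_simps [simp]:
  "aadd (free_algebra E) = (+)" "azero (free_algebra E) = 0" "amult (free_algebra E) = (*)"
  "ascale (free_algebra E) = scale"
  by (simp_all add: free_algebra_def)

lemma relators_carrier:
  assumes "wf_digraph E" shows "relators E \<subseteq> acarrier (free_algebra E)"
proof
  interpret wf_digraph E by fact
  fix x :: "('a, 'b, 'c) free_elem" assume "x \<in> relators E"
  then show "x \<in> acarrier (free_algebra E)"
    by cases (auto intro!: fc_diff fc_mult fc_sum fc_gen simp: regular_def)
qed

lemma relators_act_0:
  fixes x :: "('v, 'e, 'k::field) free_elem"
  assumes "x \<in> relators E" "q \<in> tail_class E p"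
  shows "free_action E x (Poly_Mapping.single q 1) = 0"
proof -
  have q: "shd q \<in> arcs E" "head E (shd q) = tail E (shd (stl q))"
    using assms(2) ip_SCons[of E "shd q" "stl q"] by (auto simp: tail_class_def)
  show ?thesis
    using assms(1)
  proof cases
    case (9 v)
    have "free_action E (ed e * gh e) (Poly_Mapping.single q (1::'k)) =
        (if shd q = e then Poly_Mapping.single q (1::'k) else 0)" for e
      using q by (auto simp: fa_mult)
    then have "(\<Sum>e\<in>out_arcs E v. free_action E (ed e * gh e) (Poly_Mapping.single q (1::'k))) =
        (\<Sum>e\<in>out_arcs E v. if shd q = e then Poly_Mapping.single q (1::'k) else 0)"
      by simp
    also have "\<dots> = (if shd q \<in> out_arcs E v then Poly_Mapping.single q (1::'k) else 0)"
      using 9(2) by (simp add: regular_def del: in_out_arcs_conv)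
    finally show ?thesis
      using 9(1) q by (auto simp: fa_diff fa_sum_left)
  qed (use q in \<open>auto simp: fa_mult fa_diff\<close>)
qed

definition free_annihilator where
  "free_annihilator E p = {x \<in> acarrier (free_algebra E). \<forall>m\<in>chen_module E p. free_action E x m = 0}"

lemma kills_ideal: "is_ideal (free_algebra E) (free_annihilator E p)"
  by (auto simp: is_ideal_def free_annihilator_def fc_zero fc_add fc_scale fc_mult fa_add fa_scale fa_mult cm_free)

lemma relators_kills:
  assumes "wf_digraph E" shows "relators E \<subseteq> free_annihilator E p"
proof
  fix x :: "('a, 'b, 'c) free_elem" assume x: "x \<in> relators E"
  have "free_action E x m = 0" if "m \<in> chen_module E p" for m
  proof -
    have 1: "free_action E x (Poly_Mapping.single q k) = 0" if "q \<in> tail_class E p" for q k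
      using relators_act_0[OF x that] fa_scale_right[of E x k "Poly_Mapping.single q 1"] by simp
    have "free_action E x m =
        (\<Sum>q\<in>Poly_Mapping.keys m. free_action E x (Poly_Mapping.single q (Poly_Mapping.lookup m q)))"
      by (subst (1) poly_mapping_expand[of m]) (rule fa_sum_right)
    also have "\<dots> = 0"
      using that by (intro sum.neutral ballI 1) (auto simp: chen_module_def)
    finally show ?thesis .
  qed
  with x relators_carrier[OF assms] show "x \<in> free_annihilator E p" by (auto simp: free_annihilator_def)
qed

lemma free_carrier_ideal: "is_ideal (free_algebra E) (acarrier (free_algebra E))"
  by (auto simp: is_ideal_def fc_zero fc_add fc_scale fc_mult)

lemma relation_ideal_ideal:
  assumes "wf_digraph E" shows "is_ideal (free_algebra E) (relation_ideal E)"
  using free_carrier_ideal[of E] relators_carrier[OF assms]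
  unfolding relation_ideal_def ideal_gen_def by (auto simp: is_ideal_def)

lemma relation_ideal_closed:
  assumes "wf_digraph E"
  shows "x \<in> relation_ideal E \<Longrightarrow> x \<in> acarrier (free_algebra E)"
    and "0 \<in> relation_ideal E"
    and "x \<in> relation_ideal E \<Longrightarrow> y \<in> relation_ideal E \<Longrightarrow> x + y \<in> relation_ideal E"
    and "x \<in> relation_ideal E \<Longrightarrow> scale k x \<in> relation_ideal E"
    and "a \<in> acarrier (free_algebra E) \<Longrightarrow> x \<in> relation_ideal E \<Longrightarrow> a * x \<in> relation_ideal E"
    and "a \<in> acarrier (free_algebra E) \<Longrightarrow> x \<in> relation_ideal E \<Longrightarrow> x * a \<in> relation_ideal E"
  by (use relation_ideal_ideal[OF assms, unfolded is_ideal_def, simplified] in blast)+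

lemma lpa_action_class:
  fixes x :: "('a, 'b, 'c::field) free_elem"
  assumes "wf_digraph E" "m \<in> chen_module E p"
  shows "lpa_action E (lpa_class E x) m = free_action E x m"
proof -
  have "(relation_ideal E :: ('a, 'b, 'c) free_elem set) \<subseteq> free_annihilator E p"
    unfolding relation_ideal_def ideal_gen_def using kills_ideal relators_kills[OF assms(1)] by blast
  then have "free_action E (x + y) m = free_action E x m" if "y \<in> relation_ideal E" for y :: "('a, 'b, 'c) free_elem"
    using that assms(2) by (auto simp: free_annihilator_def fa_add)
  moreover have "(0 :: ('a, 'b, 'c) free_elem) \<in> relation_ideal E"
    by (rule relation_ideal_closed(2)[OF assms(1)])
  ultimately have "(\<lambda>x. free_action E x m) ` lpa_class E x = {free_action E x m}"
    by (auto simp: lpa_class_def coset_def)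
  then show ?thesis by (simp add: lpa_action_def)
qed

lemma relation_ideal_minus: 
  assumes "wf_digraph E" "x \<in> relation_ideal E" shows "- x \<in> relation_ideal E"
proof -
  have "scale (-1) x \<in> relation_ideal E" 
    by (rule relation_ideal_closed(4)[OF assms])
  moreover have "scale (-1) x = - x" by (rule poly_mapping_eqI) simp
  ultimately show ?thesis by simp
qed

lemma lpa_class_eq_iff:
  fixes x y :: "('a, 'b, 'c::field) free_elem"
  assumes "wf_digraph E"
  shows "lpa_class E x = lpa_class E y \<longleftrightarrow> x - y \<in> relation_ideal E"
proof -
  note I = relation_ideal_closed[OF assms]
  have 0: "z \<in> lpa_class E x \<longleftrightarrow> z - x \<in> relation_ideal E" for x z :: "('a, 'b, 'c) free_elem"
    by (auto simp: lpa_class_def coset_def) (metis add.commute diff_add_cancel)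
  show ?thesis
  proof
    assume "lpa_class E x = lpa_class E y"
    then have "x \<in> lpa_class E y" using 0[of x x] I(2) by simp
    then show "x - y \<in> relation_ideal E" using 0 by simp
  next
    assume A: "x - y \<in> relation_ideal E"
    then have A': "y - x \<in> relation_ideal E" using relation_ideal_minus[OF assms A] by simp
    have "z - x \<in> relation_ideal E \<longleftrightarrow> z - y \<in> relation_ideal E" for z :: "('a, 'b, 'c) free_elem"
    proof
      assume "z - x \<in> relation_ideal E"
      then have "(z - x) + (x - y) \<in> relation_ideal E" using A by (intro I(3))
      then show "z - y \<in> relation_ideal E" by simp
    next
      assume "z - y \<in> relation_ideal E"
      then have "(z - y) + (y - x) \<in> relation_ideal E" using A' by (intro I(3))
      then show "z - x \<in> relation_ideal E" by simp
    qed
    then show "lpa_class E x = lpa_class E y" using 0 by blast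
  qed
qed

lemma lpa_class_rep:
  assumes "wf_digraph E" "x' \<in> lpa_class E x"
  shows "x' - x \<in> relation_ideal E"
  using assms(2) by (auto simp: lpa_class_def coset_def)

lemma lpa_class_self: "wf_digraph E \<Longrightarrow> x \<in> lpa_class E x"
  using relation_ideal_closed(2)[of E] by (force simp: lpa_class_def coset_def)

lemma lpa_ops:
  fixes x y :: "('a, 'b, 'c::field) free_elem"
  assumes "wf_digraph E"
  shows "acarrier (lpa E) = lpa_class E ` acarrier (free_algebra E)"
    and "azero (lpa E) = lpa_class E 0"
    and "aadd (lpa E) (lpa_class E x) (lpa_class E y) = lpa_class E (x + y)"
    and "ascale (lpa E) k (lpa_class E x) = lpa_class E (scale k x)"
    and "x \<in> acarrier (free_algebra E) \<Longrightarrow> y \<in> acarrier (free_algebra E) \<Longrightarrow>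
      amult (lpa E) (lpa_class E x) (lpa_class E y) = lpa_class E (x * y)"
proof -
  note I = relation_ideal_closed[OF assms]
  note self = lpa_class_self[OF assms] and rep = lpa_class_rep[OF assms]
    and eq = lpa_class_eq_iff[OF assms]
  show "acarrier (lpa E) = lpa_class E ` acarrier (free_algebra E)"
    and "azero (lpa E) = lpa_class E 0"
    by (simp_all add: lpa_def lpa_class_def quotient_algebra_def)
  have op: "aadd (lpa E) X Y = (\<Union>x\<in>X. \<Union>y\<in>Y. lpa_class E (x + y))"
    "ascale (lpa E) k X = (\<Union>x\<in>X. lpa_class E (scale k x))"
    "amult (lpa E) X Y = (\<Union>x\<in>X. \<Union>y\<in>Y. lpa_class E (x * y))"
    for X Y :: "('a, 'b, 'c) lpa_elem"
    by (simp_all add: lpa_def quotient_algebra_def lpa_class_def)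
  have "lpa_class E (x' + y') = lpa_class E (x + y)"
    if "x' \<in> lpa_class E x" "y' \<in> lpa_class E y" for x' y'
  proof -
    have "(x' - x) + (y' - y) \<in> relation_ideal E" using that by (intro I(3) rep)
    then show ?thesis by (simp add: eq algebra_simps)
  qed
  then show "aadd (lpa E) (lpa_class E x) (lpa_class E y) = lpa_class E (x + y)"
    unfolding op(1) using self[of x] self[of y] by blast
  have "lpa_class E (scale k x') = lpa_class E (scale k x)" if "x' \<in> lpa_class E x" for x'
  proof -
    have "scale k (x' - x) \<in> relation_ideal E" using that by (intro I(4) rep)
    moreover have "scale k (x' - x) = scale k x' - scale k x"
      by (rule poly_mapping_eqI) (simp add: lookup_minus algebra_simps)
    ultimately show ?thesis by (simp add: eq)
  qed
  then show "ascale (lpa E) k (lpa_class E x) = lpa_class E (scale k x)"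
    unfolding op(2) using self[of x] by blast
  assume xy: "x \<in> acarrier (free_algebra E)" "y \<in> acarrier (free_algebra E)"
  have "lpa_class E (x' * y') = lpa_class E (x * y)"
    if "x' \<in> lpa_class E x" "y' \<in> lpa_class E y" for x' y'
  proof -
    have d: "x' - x \<in> relation_ideal E" "y' - y \<in> relation_ideal E" using that by (auto intro: rep)
    then have "y' - y \<in> acarrier (free_algebra E)" by (intro I(1))
    then have "y' \<in> acarrier (free_algebra E)" using fc_add[OF _ xy(2)] by fastforce
    then have "(x' - x) * y' \<in> relation_ideal E" "x * (y' - y) \<in> relation_ideal E"
      using d xy by (auto intro: I(5,6))
    then have "(x' - x) * y' + x * (y' - y) \<in> relation_ideal E" by (intro I(3))
    then show ?thesis by (simp add: eq algebra_simps)
  qed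
  then show "amult (lpa E) (lpa_class E x) (lpa_class E y) = lpa_class E (x * y)"
    unfolding op(3) using self[of x] self[of y] by blast
qed

end

theory Submission
  imports Defs
begin

text \<open>
  Call a vertex live if it reaches a vertex of \<open>p\<close>, that is, if it lies outside \<open>H = H(p)\<close>, and an arc
  live if its head is live.  All vertices and arcs on a path of the class \<open>[p]\<close> are live, and every
  live vertex is the source of some path in \<open>[p]\<close>.

  One inclusion is a calculation on basis vectors \<open>q \<in> [p]\<close>.  The vertices in \<open>H\<close> and the breaking
  elements kill \<open>q\<close> because its source and its first arc are live.  If \<open>p\<close> ends in an exclusive cycle \<open>c\<close> at \<open>v\<close>, then
  \<open>c\<^sup>\<infinity>\<close> is the only path of \<open>[p]\<close> from \<open>v\<close> (\<open>exclusive_paths_from\<close>), so \<open>c - v\<close> kills \<open>q\<close> too.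

  For the other inclusion let \<open>J\<close> be the preimage of the ideal in the free algebra and let \<open>x\<close>
  annihilate the module.  Modulo \<open>J\<close> the arcs into \<open>H\<close> vanish, so a live vertex \<open>u\<close> with finitely many
  live arcs is the sum of the \<open>e e\<^sup>*\<close> over them, whether \<open>u\<close> is regular or breaking
  (\<open>live_vertex_sum\<close>).  By the usual reductions \<open>x\<close> is congruent to a combination of normal words
  \<open>\<alpha> \<beta>\<^sup>*\<close> with paths \<open>\<alpha>\<close>, \<open>\<beta>\<close> of the same range.  The terms whose \<open>\<beta>\<close> starts at a fixed \<open>u\<close> form \<open>x u\<close>
  up to congruence and may be treated separately; \<open>normal_annihilator\<close> shows that they lie in \<open>J\<close>,
  by induction on the maximal length of \<open>\<beta>\<close>.

  Suppose first that all \<open>\<beta>\<close> are trivial, so that the element is \<open>\<Sum> k\<^sub>\<alpha> \<alpha>\<close> with all \<open>\<alpha>\<close> ending at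
  \<open>u\<close>.  Applied to \<open>q\<close> it gives \<open>\<Sum> k\<^sub>\<alpha> \<alpha>q = 0\<close>, and it lies in \<open>J\<close> as soon as \<open>\<alpha>q = \<alpha>'q\<close> implies
  \<open>\<alpha> \<equiv> \<alpha>'\<close> modulo \<open>J\<close>.  A path \<open>q\<close> with that property exists (\<open>separating_path\<close>): a coincidence
  \<open>\<alpha>q = \<alpha>'q\<close> with \<open>\<alpha> \<noteq> \<alpha>'\<close> forces \<open>\<alpha>' = \<alpha>\<gamma>\<close> and \<open>q = \<gamma>\<^sup>\<infinity>\<close> up to symmetry, so only finitely many \<open>q\<close> are
  bad.  If there are only finitely many paths from \<open>u\<close> in \<open>[p]\<close> and one of them is \<open>\<gamma>\<^sup>\<infinity>\<close>, then \<open>\<gamma>\<close> has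
  no live exit, whence \<open>p\<close> ends in an exclusive cycle.  In that case \<open>c - v \<in> J\<close> for such a cycle \<open>c\<close>,
  and \<open>\<gamma>\<close> is a power of a rotation of \<open>c\<close>, hence congruent to its base vertex, so that \<open>\<alpha>' \<equiv> \<alpha>\<close>.

  For the induction step let \<open>y\<close> be a combination of terms whose \<open>\<beta>\<close> start at \<open>u\<close>.  For an arc \<open>e\<close> the
  element \<open>y e\<close> has shorter ghost parts than \<open>y\<close>.  If \<open>u\<close> has finitely many live arcs,
  \<open>y \<equiv> \<Sum> (y e) e\<^sup>*\<close> lies in \<open>J\<close>.  Otherwise infinitely many \<open>q\<close> start with an arc that begins no \<open>\<beta>\<close>.
  They kill all terms with nontrivial \<open>\<beta>\<close>, and one of them gives distinct \<open>\<alpha>q\<close> for the other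
  terms, which therefore vanish.  The terms that were killed are again congruent to \<open>\<Sum> (y e) e\<^sup>*\<close>, now over the
  finitely many arcs that begin some \<open>\<beta>\<close>.
\<close>

section \<open>Words and supports in the free algebra\<close>

abbreviation mon :: "('v, 'e) generator list \<Rightarrow> ('v, 'e, 'k::field) free_elem" where
  "mon w \<equiv> Poly_Mapping.single w 1"

lemma mon_append: "mon (u @ w) = mon u * mon w"
  by (simp add: mult_single plus_list_def)

lemma mon_Nil: "mon [] = 1"
  by (metis single_one zero_list_def)

lemma mon_expand: "x = (\<Sum>w\<in>Poly_Mapping.keys x. scale (Poly_Mapping.lookup x w) (mon w))"
  using poly_mapping_expand[of x] by simp

lemma scale_mult_left:
  fixes x y :: "('v, 'e, 'k::field) free_elem"
  shows "scale k x * y = scale k (x * y)"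
  by (simp add: mult_map_scale_conv_mult mult.assoc)

lemma mult_expand:
  "x * c = (\<Sum>w\<in>Poly_Mapping.keys x. scale (Poly_Mapping.lookup x w) (mon w * c))"
proof -
  have "x * c = (\<Sum>w\<in>Poly_Mapping.keys x. scale (Poly_Mapping.lookup x w) (mon w)) * c"
    by (simp only: mon_expand[symmetric])
  then show ?thesis by (simp only: sum_distrib_right scale_mult_left)
qed

lemma scale_sum_left: "scale (\<Sum>a\<in>A. f a) x = (\<Sum>a\<in>A. scale (f a) x)"
  by (rule poly_mapping_eqI) (simp add: lookup_sum sum_distrib_right)

lemma prod_list_ed: "prod_list (map ed c) = mon (map Edge c)"
proof (induction c)
  case (Cons e c)
  then show ?case by (simp add: mult_single plus_list_def)
qed (simp add: mon_Nil)

definition part :: "('a \<Rightarrow> bool) \<Rightarrow> ('a \<Rightarrow>\<^sub>0 'k::field) \<Rightarrow> ('a \<Rightarrow>\<^sub>0 'k)" where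
  "part P x = (\<Sum>w | w \<in> Poly_Mapping.keys x \<and> P w. Poly_Mapping.single w (Poly_Mapping.lookup x w))"

lemma lookup_part: "Poly_Mapping.lookup (part P x) w = (if P w then Poly_Mapping.lookup x w else 0)"
proof -
  have "Poly_Mapping.lookup (part P x) w =
      (\<Sum>w' | w' \<in> Poly_Mapping.keys x \<and> P w'. if w' = w then Poly_Mapping.lookup x w else 0)"
    unfolding part_def lookup_sum by (intro sum.cong) (auto simp: lookup_single when_def)
  also have "\<dots> = (if P w then Poly_Mapping.lookup x w else 0)"
    by (subst sum.delta) (auto simp: in_keys_iff)
  finally show ?thesis .
qed

lemma keys_part: "Poly_Mapping.keys (part P x) = {w \<in> Poly_Mapping.keys x. P w}"
  by (auto simp: in_keys_iff lookup_part split: if_splits)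

lemma part_add: "part P x + part (\<lambda>w. \<not> P w) x = x"
  by (rule poly_mapping_eqI) (simp add: lookup_add lookup_part)

lemma sum_part:
  "(\<Sum>u\<in>\<rho> ` Poly_Mapping.keys x. part (\<lambda>w. \<rho> w = u) x) = x"
proof (rule poly_mapping_eqI)
  fix w
  show "Poly_Mapping.lookup (\<Sum>u\<in>\<rho> ` Poly_Mapping.keys x. part (\<lambda>w. \<rho> w = u) x) w = Poly_Mapping.lookup x w"
    unfolding lookup_sum lookup_part by (subst sum.delta') (auto simp: in_keys_iff)
qed

section \<open>Congruence modulo an ideal containing the relations\<close>

text \<open>
  Working with ideals of the free algebra instead of quotients keeps representatives explicit: two
  elements agree in a quotient of the Leavitt path algebra iff they are congruent modulo such an ideal.
\<close>
locale leavitt_ideal = wf_digraph E for E :: "('v, 'e) pre_digraph" +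
  fixes J :: "('v, 'e, 'k::field) free_elem set"
  assumes ideal: "is_ideal (free_algebra E) J" and relators_in: "relators E \<subseteq> J"
begin

(* As an automatic elimination rule awalkE would unfold every walk in sight. *)
declare awalkE [rule del]

lemma J_carrier: "x \<in> J \<Longrightarrow> x \<in> acarrier (free_algebra E)"
  and J_zero [simp]: "0 \<in> J"
  and J_add: "x \<in> J \<Longrightarrow> y \<in> J \<Longrightarrow> x + y \<in> J"
  and J_scale: "x \<in> J \<Longrightarrow> scale k x \<in> J"
  and J_mult_left: "a \<in> acarrier (free_algebra E) \<Longrightarrow> x \<in> J \<Longrightarrow> a * x \<in> J"
  and J_mult_right: "a \<in> acarrier (free_algebra E) \<Longrightarrow> x \<in> J \<Longrightarrow> x * a \<in> J"
  using ideal by (auto simp: is_ideal_def)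

lemma J_minus: "x \<in> J \<Longrightarrow> - x \<in> J"
proof -
  assume "x \<in> J"
  then have "scale (-1) x \<in> J" by (rule J_scale)
  moreover have "scale (-1) x = - x" by (rule poly_mapping_eqI) simp
  ultimately show "- x \<in> J" by simp
qed

lemma J_diff: "x \<in> J \<Longrightarrow> y \<in> J \<Longrightarrow> x - y \<in> J"
  using J_add[of x "- y"] J_minus[of y] by simp

lemma J_sum: "(\<And>a. a \<in> A \<Longrightarrow> f a \<in> J) \<Longrightarrow> (\<Sum>a\<in>A. f a) \<in> J"
  by (induction A rule: infinite_finite_induct) (auto intro: J_add)

lemma mon_carrier: "w \<noteq> [] \<Longrightarrow> set w \<subseteq> generators E \<Longrightarrow> mon w \<in> acarrier (free_algebra E)"
  by (simp add: free_algebra_def)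

text \<open>
  The empty word is outside the nonunital free algebra, but an ideal is stable under multiplication
  by it as well; hence congruences may be used inside arbitrary, possibly empty, contexts.
\<close>
lemma J_mon_left: "set w \<subseteq> generators E \<Longrightarrow> x \<in> J \<Longrightarrow> mon w * x \<in> J"
  by (cases "w = []") (auto simp: mon_Nil intro!: J_mult_left mon_carrier)

lemma J_mon_right: "set w \<subseteq> generators E \<Longrightarrow> x \<in> J \<Longrightarrow> x * mon w \<in> J"
  by (cases "w = []") (auto simp: mon_Nil intro!: J_mult_right mon_carrier)

definition cong :: "('v, 'e, 'k) free_elem \<Rightarrow> ('v, 'e, 'k) free_elem \<Rightarrow> bool" (infix "\<approx>" 50) where
  "x \<approx> y \<longleftrightarrow> x - y \<in> J"

lemma cong_refl [simp, intro]: "x \<approx> x"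
  by (simp add: cong_def)

lemma cong_sym: "x \<approx> y \<Longrightarrow> y \<approx> x"
  using J_minus[of "x - y"] by (simp add: cong_def)

lemma cong_trans [trans]: "x \<approx> y \<Longrightarrow> y \<approx> z \<Longrightarrow> x \<approx> z"
  using J_add[of "x - y" "y - z"] by (simp add: cong_def)

lemma cong_zero: "x \<approx> 0 \<longleftrightarrow> x \<in> J"
  by (simp add: cong_def)

lemma cong_in: "x \<approx> y \<Longrightarrow> y \<in> J \<Longrightarrow> x \<in> J"
  using cong_trans[of x y 0] by (simp add: cong_zero)

lemma cong_add: "x \<approx> y \<Longrightarrow> x' \<approx> y' \<Longrightarrow> x + x' \<approx> y + y'"
  using J_add[of "x - y" "x' - y'"] by (simp add: cong_def algebra_simps)

lemma cong_scale: "x \<approx> y \<Longrightarrow> scale k x \<approx> scale k y"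
proof -
  assume "x \<approx> y"
  then have "scale k (x - y) \<in> J" by (simp add: cong_def J_scale)
  moreover have "scale k (x - y) = scale k x - scale k y"
    by (rule poly_mapping_eqI) (simp add: lookup_minus algebra_simps)
  ultimately show ?thesis by (simp add: cong_def)
qed

lemma cong_sum: "(\<And>a. a \<in> A \<Longrightarrow> f a \<approx> g a) \<Longrightarrow> (\<Sum>a\<in>A. f a) \<approx> (\<Sum>a\<in>A. g a)"
  by (induction A rule: infinite_finite_induct) (auto intro: cong_add)

lemma cong_mult_left: "x \<approx> y \<Longrightarrow> a \<in> acarrier (free_algebra E) \<Longrightarrow> a * x \<approx> a * y"
  using J_mult_left[of a "x - y"] by (simp add: cong_def algebra_simps)

lemma cong_context:
  assumes "mon w \<approx> mon w'" "set u \<subseteq> generators E" "set t \<subseteq> generators E"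
  shows "mon (u @ w @ t) \<approx> mon (u @ w' @ t)"
proof -
  have "mon u * (mon w - mon w') * mon t \<in> J"
    using assms by (intro J_mon_left J_mon_right) (auto simp: cong_def)
  then show ?thesis by (simp add: cong_def mon_append algebra_simps)
qed

lemma J_context:
  assumes "mon w \<in> J" "set u \<subseteq> generators E" "set t \<subseteq> generators E"
  shows "mon (u @ w @ t) \<in> J"
proof -
  have "mon u * mon w * mon t \<in> J"
    using assms by (intro J_mon_left J_mon_right)
  then show ?thesis by (simp add: mon_append mult.assoc)
qed

lemma cong_mult_expand:
  assumes "\<And>w. w \<in> Poly_Mapping.keys x \<Longrightarrow> mon w * a \<approx> mon w * b"
  shows "x * a \<approx> x * b"
  unfolding mult_expand[of x a] mult_expand[of x b]
  by (intro cong_sum cong_scale assms)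

section \<open>Normal forms\<close>

lemma rel_mon:
  shows "v \<in> verts E \<Longrightarrow> mon [Vertex v, Vertex v] \<approx> mon [Vertex v]"
    and "u \<in> verts E \<Longrightarrow> v \<in> verts E \<Longrightarrow> u \<noteq> v \<Longrightarrow> mon [Vertex u, Vertex v] \<in> J"
    and "e \<in> arcs E \<Longrightarrow> mon [Vertex (tail E e), Edge e] \<approx> mon [Edge e]"
    and "e \<in> arcs E \<Longrightarrow> mon [Edge e, Vertex (head E e)] \<approx> mon [Edge e]"
    and "e \<in> arcs E \<Longrightarrow> mon [Vertex (head E e), Ghost e] \<approx> mon [Ghost e]"
    and "e \<in> arcs E \<Longrightarrow> mon [Ghost e, Vertex (tail E e)] \<approx> mon [Ghost e]"
    and "e \<in> arcs E \<Longrightarrow> mon [Ghost e, Edge e] \<approx> mon [Vertex (head E e)]"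
    and "e \<in> arcs E \<Longrightarrow> f \<in> arcs E \<Longrightarrow> e \<noteq> f \<Longrightarrow> mon [Ghost e, Edge f] \<in> J"
  using relators.intros(1-8)[THEN subsetD[OF relators_in]]
  by (simp_all add: cong_def mult_single plus_list_def)

lemma gens [simp]:
  "Vertex v \<in> generators E \<longleftrightarrow> v \<in> verts E"
  "Edge e \<in> generators E \<longleftrightarrow> e \<in> arcs E"
  "Ghost e \<in> generators E \<longleftrightarrow> e \<in> arcs E"
  by (auto simp: generators_def)

text \<open>
  Inserting the source or range vertex of the arc turns a mismatch into a product of two distinct
  orthogonal idempotents.
\<close>
lemma rel_mon_mismatch:
  shows "u \<in> verts E \<Longrightarrow> e \<in> arcs E \<Longrightarrow> u \<noteq> tail E e \<Longrightarrow> mon [Vertex u, Edge e] \<in> J"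
    and "u \<in> verts E \<Longrightarrow> e \<in> arcs E \<Longrightarrow> u \<noteq> head E e \<Longrightarrow> mon [Edge e, Vertex u] \<in> J"
    and "u \<in> verts E \<Longrightarrow> e \<in> arcs E \<Longrightarrow> u \<noteq> head E e \<Longrightarrow> mon [Vertex u, Ghost e] \<in> J"
    and "u \<in> verts E \<Longrightarrow> e \<in> arcs E \<Longrightarrow> u \<noteq> tail E e \<Longrightarrow> mon [Ghost e, Vertex u] \<in> J"
proof -
  assume u: "u \<in> verts E" and e: "e \<in> arcs E"
  { assume "u \<noteq> tail E e"
    then have "mon ([] @ [Vertex u, Vertex (tail E e)] @ [Edge e]) \<in> J"
      using u e by (intro J_context rel_mon) auto
    moreover have "mon ([Vertex u] @ [Vertex (tail E e), Edge e] @ []) \<approx> mon ([Vertex u] @ [Edge e] @ [])"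
      using u e by (intro cong_context rel_mon) auto
    ultimately show "mon [Vertex u, Edge e] \<in> J" using cong_in cong_sym by fastforce }
  { assume "u \<noteq> head E e"
    then have "mon ([Edge e] @ [Vertex (head E e), Vertex u] @ []) \<in> J"
      using u e by (intro J_context rel_mon) auto
    moreover have "mon ([] @ [Edge e, Vertex (head E e)] @ [Vertex u]) \<approx> mon ([] @ [Edge e] @ [Vertex u])"
      using u e by (intro cong_context rel_mon) auto
    ultimately show "mon [Edge e, Vertex u] \<in> J" using cong_in cong_sym by fastforce }
  { assume "u \<noteq> head E e"
    then have "mon ([] @ [Vertex u, Vertex (head E e)] @ [Ghost e]) \<in> J"
      using u e by (intro J_context rel_mon) auto
    moreover have "mon ([Vertex u] @ [Vertex (head E e), Ghost e] @ []) \<approx> mon ([Vertex u] @ [Ghost e] @ [])"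
      using u e by (intro cong_context rel_mon) auto
    ultimately show "mon [Vertex u, Ghost e] \<in> J" using cong_in cong_sym by fastforce }
  { assume "u \<noteq> tail E e"
    then have "mon ([Ghost e] @ [Vertex (tail E e), Vertex u] @ []) \<in> J"
      using u e by (intro J_context rel_mon) auto
    moreover have "mon ([] @ [Ghost e, Vertex (tail E e)] @ [Vertex u]) \<approx> mon ([] @ [Ghost e] @ [Vertex u])"
      using u e by (intro cong_context rel_mon) auto
    ultimately show "mon [Ghost e, Vertex u] \<in> J" using cong_in cong_sym by fastforce }
qed

text \<open>
  The word \<open>\<alpha> v \<beta>\<^sup>*\<close>.  The middle vertex makes the trivial paths \<open>\<alpha> = v\<close> or \<open>\<beta> = v\<close> unexceptional.
\<close>
definition normal_word :: "'e list \<Rightarrow> 'v \<Rightarrow> 'e list \<Rightarrow> ('v, 'e) generator list" where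
  "normal_word \<alpha> v \<beta> = map Edge \<alpha> @ Vertex v # map Ghost (rev \<beta>)"

text \<open>
  As \<open>\<beta>\<^sup>*\<close> runs backwards, a normal word ends at the source \<open>w\<close> of \<open>\<beta>\<close>; this is the vertex that fixes
  it under right multiplication.
\<close>
definition normal_words :: "'v \<Rightarrow> nat \<Rightarrow> ('v, 'e) generator list set" where
  "normal_words w n = {normal_word \<alpha> v \<beta> |\<alpha> v \<beta>. (\<exists>u. awalk u \<alpha> v) \<and> awalk w \<beta> v \<and> length \<beta> \<le> n}"

lemma normal_word_gens: "awalk u \<alpha> v \<Longrightarrow> awalk w \<beta> v \<Longrightarrow> set (normal_word \<alpha> v \<beta>) \<subseteq> generators E"
  using awalk_last_in_verts[of u \<alpha> v] by (auto simp: normal_word_def awalk_def)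

lemma awalk_gens:
  "awalk u \<alpha> v \<Longrightarrow> set (map Edge \<alpha>) \<subseteq> generators E"
  "awalk u \<alpha> v \<Longrightarrow> set (map Ghost (rev \<alpha>)) \<subseteq> generators E"
  "awalk u \<alpha> v \<Longrightarrow> u \<in> verts E" "awalk u \<alpha> v \<Longrightarrow> v \<in> verts E"
  using awalk_last_in_verts[of u \<alpha> v] by (auto simp: awalk_def)

lemma normal_wordsI:
  "awalk u \<alpha> v \<Longrightarrow> awalk w \<beta> v \<Longrightarrow> length \<beta> \<le> n \<Longrightarrow> normal_word \<alpha> v \<beta> \<in> normal_words w n"
  unfolding normal_words_def by blast

lemma normal_wordsE:
  assumes "w \<in> normal_words u n"
  obtains \<alpha> v \<beta> a where "w = normal_word \<alpha> v \<beta>" "awalk a \<alpha> v" "awalk u \<beta> v" "length \<beta> \<le> n"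
  using assms unfolding normal_words_def by blast

lemma in_normal_words:
  "awalk u \<alpha> v \<Longrightarrow> awalk w \<beta> v \<Longrightarrow> normal_word \<alpha> v \<beta> \<in> (\<Union>u n. normal_words u n)"
  by (meson UN_I UNIV_I normal_wordsI order_refl)

text \<open>
  A generator in front of \<open>\<alpha> v \<beta>\<^sup>*\<close> is either absorbed, or extends \<open>\<alpha>\<close>, or cancels against the first arc
  of \<open>\<alpha>\<close>; a ghost arc in front of a trivial \<open>\<alpha>\<close> extends \<open>\<beta>\<close> at its far end.  Each incompatible
  combination is a zero product.
\<close>
lemma normal_word_Cons:
  assumes g: "g \<in> generators E" and \<alpha>: "awalk u \<alpha> v" and \<beta>: "awalk w \<beta> v"
  shows "mon (g # normal_word \<alpha> v \<beta>) \<in> J \<or>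
    (\<exists>w'\<in>(\<Union>u n. normal_words u n). mon (g # normal_word \<alpha> v \<beta>) \<approx> mon w')"
proof -
  let ?t = "Vertex v # map Ghost (rev \<beta>)"
  note G = awalk_gens[OF \<alpha>] awalk_gens[OF \<beta>]
  have nwI: "normal_word \<alpha>' v' \<beta>' \<in> (\<Union>u n. normal_words u n)" if "awalk u' \<alpha>' v'" "awalk w' \<beta>' v'" for u' \<alpha>' v' w' \<beta>'
    using in_normal_words[OF that] .
  have nw: "normal_word \<alpha> v \<beta> \<in> (\<Union>u n. normal_words u n)" by (rule nwI[OF \<alpha> \<beta>])
  show ?thesis
  proof (cases g)
    case (Vertex x)
    with g have x: "x \<in> verts E" by simp
    show ?thesis
    proof (cases \<alpha>)
      case Nil
      show ?thesis
      proof (cases "x = v")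
        case True
        have "mon ([] @ [Vertex v, Vertex v] @ map Ghost (rev \<beta>)) \<approx> mon ([] @ [Vertex v] @ map Ghost (rev \<beta>))"
          using G by (intro cong_context rel_mon) auto
        with Nil True Vertex nw show ?thesis by (auto simp: normal_word_def)
      next
        case False
        have "mon ([] @ [Vertex x, Vertex v] @ map Ghost (rev \<beta>)) \<in> J"
          using G x False by (intro J_context rel_mon) auto
        with Nil Vertex show ?thesis by (auto simp: normal_word_def)
      qed
    next
      case (Cons f \<alpha>')
      show ?thesis
      proof (cases "x = tail E f")
        case True
        have "mon ([] @ [Vertex x, Edge f] @ map Edge \<alpha>' @ ?t) \<approx> mon ([] @ [Edge f] @ map Edge \<alpha>' @ ?t)"
          unfolding True using G Cons by (intro cong_context rel_mon) auto
        with Cons Vertex nw show ?thesis by (auto simp: normal_word_def)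
      next
        case False
        have "mon ([] @ [Vertex x, Edge f] @ map Edge \<alpha>' @ ?t) \<in> J"
          using G x False Cons by (intro J_context rel_mon_mismatch) auto
        with Cons Vertex show ?thesis by (auto simp: normal_word_def)
      qed
    qed
  next
    case (Edge e)
    with g have e: "e \<in> arcs E" by simp
    show ?thesis
    proof (cases "head E e = u")
      case True
      with e \<alpha> have "awalk (tail E e) (e # \<alpha>) v" by (simp add: awalk_Cons_iff)
      from nwI[OF this \<beta>] show ?thesis using Edge by (auto simp: normal_word_def)
    next
      case False
      have "mon [Edge e, hd (normal_word \<alpha> v \<beta>)] \<in> J"
      proof (cases \<alpha>)
        case Nil
        then show ?thesis using e False \<alpha> rel_mon_mismatch(2)[of v e] by (auto simp: normal_word_def awalk_Nil_iff)
      next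
        case (Cons f \<alpha>')
        with \<alpha> have f: "f \<in> arcs E" "tail E f = u" by (auto simp: awalk_Cons_iff)
        have "mon ([] @ [Edge e, Vertex u] @ [Edge f]) \<in> J"
          using e f False by (intro J_context rel_mon_mismatch) auto
        moreover have "mon ([Edge e] @ [Vertex u, Edge f] @ []) \<approx> mon ([Edge e] @ [Edge f] @ [])"
          using e f rel_mon(3)[of f] by (intro cong_context) auto
        ultimately show ?thesis using Cons cong_in cong_sym by (fastforce simp: normal_word_def)
      qed
      then have "mon ([] @ [Edge e, hd (normal_word \<alpha> v \<beta>)] @ tl (normal_word \<alpha> v \<beta>)) \<in> J"
        using normal_word_gens[OF \<alpha> \<beta>]
        by (intro J_context) (cases "normal_word \<alpha> v \<beta>"; auto)+
      moreover have "normal_word \<alpha> v \<beta> \<noteq> []" by (simp add: normal_word_def)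
      ultimately show ?thesis using Edge by simp
    qed
  next
    case (Ghost e)
    with g have e: "e \<in> arcs E" by simp
    show ?thesis
    proof (cases \<alpha>)
      case Nil
      show ?thesis
      proof (cases "tail E e = v")
        case True
        have "mon ([] @ [Ghost e, Vertex v] @ map Ghost (rev \<beta>)) \<approx> mon ([] @ [Ghost e] @ map Ghost (rev \<beta>))"
          using True rel_mon(6)[OF e] G e by (intro cong_context) auto
        also have "\<dots> \<approx> mon ([] @ [Vertex (head E e), Ghost e] @ map Ghost (rev \<beta>))"
          using G e by (intro cong_sym[OF cong_context] rel_mon) auto
        finally have "mon (g # normal_word \<alpha> v \<beta>) \<approx> mon (normal_word [] (head E e) (\<beta> @ [e]))"
          using Nil Ghost by (simp add: normal_word_def)
        moreover have "awalk (head E e) [] (head E e)" "awalk w (\<beta> @ [e]) (head E e)"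
          using \<beta> e True by (auto simp: awalk_append_iff awalk_Nil_iff arc_implies_awalk)
        ultimately show ?thesis by (intro disjI2 bexI[OF _ nwI])
      next
        case False
        have "mon ([] @ [Ghost e, Vertex v] @ map Ghost (rev \<beta>)) \<in> J"
          using G e False by (intro J_context rel_mon_mismatch) auto
        with Nil Ghost show ?thesis by (auto simp: normal_word_def)
      qed
    next
      case (Cons f \<alpha>')
      with \<alpha> have f: "f \<in> arcs E" "awalk (head E f) \<alpha>' v" by (auto simp: awalk_Cons_iff)
      show ?thesis
      proof (cases "e = f")
        case True
        have "mon ([] @ [Ghost e, Edge f] @ map Edge \<alpha>' @ ?t) \<approx> mon ([] @ [Vertex (head E f)] @ map Edge \<alpha>' @ ?t)"
          unfolding True using G Cons by (intro cong_context rel_mon) auto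
        also have "\<dots> \<approx> mon (map Edge \<alpha>' @ ?t)"
        proof (cases \<alpha>')
          case Nil
          then have "head E f = v" using f by (simp add: awalk_Nil_iff)
          moreover have "mon ([] @ [Vertex v, Vertex v] @ map Ghost (rev \<beta>)) \<approx> mon ([] @ [Vertex v] @ map Ghost (rev \<beta>))"
            using G by (intro cong_context rel_mon) auto
          ultimately show ?thesis using Nil by simp
        next
          case (Cons h \<alpha>'')
          with f have h: "h \<in> arcs E" "tail E h = head E f" by (auto simp: awalk_Cons_iff)
          have "mon ([] @ [Vertex (tail E h), Edge h] @ map Edge \<alpha>'' @ ?t) \<approx> mon ([] @ [Edge h] @ map Edge \<alpha>'' @ ?t)"
            using G Cons \<open>\<alpha> = f # \<alpha>'\<close> by (intro cong_context rel_mon) auto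
          then show ?thesis using Cons h by simp
        qed
        finally have "mon (g # normal_word \<alpha> v \<beta>) \<approx> mon (normal_word \<alpha>' v \<beta>)"
          using Cons Ghost by (simp add: normal_word_def)
        with nwI[OF f(2) \<beta>] show ?thesis by blast
      next
        case False
        have "mon ([] @ [Ghost e, Edge f] @ map Edge \<alpha>' @ ?t) \<in> J"
          using G False Cons e by (intro J_context rel_mon) auto
        with Cons Ghost show ?thesis by (auto simp: normal_word_def)
      qed
    qed
  qed
qed

lemma word_normalizes:
  assumes "w \<noteq> []" "set w \<subseteq> generators E"
  shows "mon w \<in> J \<or> (\<exists>w'\<in>(\<Union>u n. normal_words u n). mon w \<approx> mon w')"
  using assms
proof (induction w rule: list_nonempty_induct)
  case (single g)
  then show ?case
  proof (cases g)
    case (Vertex v)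
    then have "awalk v [] v" using single by (simp add: awalk_Nil_iff)
    then have "[g] \<in> (\<Union>u n. normal_words u n)"
      using normal_wordsI[of v "[]" v v "[]" 0] Vertex by (auto simp: normal_word_def)
    then show ?thesis by blast
  next
    case (Edge e)
    then have e: "e \<in> arcs E" using single by simp
    then have "awalk (tail E e) [e] (head E e)" "awalk (head E e) [] (head E e)"
      by (auto simp: awalk_Nil_iff arc_implies_awalk)
    then have "normal_word [e] (head E e) [] \<in> (\<Union>u n. normal_words u n)"
      by (rule in_normal_words)
    moreover have "mon [g] \<approx> mon (normal_word [e] (head E e) [])"
      using cong_sym[OF rel_mon(4)[OF e]] Edge by (simp add: normal_word_def)
    ultimately show ?thesis by blast
  next
    case (Ghost e)
    then have e: "e \<in> arcs E" using single by simp
    then have "awalk (head E e) [] (head E e)" "awalk (tail E e) [e] (head E e)"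
      by (auto simp: awalk_Nil_iff arc_implies_awalk)
    then have "normal_word [] (head E e) [e] \<in> (\<Union>u n. normal_words u n)"
      by (rule in_normal_words)
    moreover have "mon [g] \<approx> mon (normal_word [] (head E e) [e])"
      using cong_sym[OF rel_mon(5)[OF e]] Ghost by (simp add: normal_word_def)
    ultimately show ?thesis by blast
  qed
next
  case (cons g w)
  then have g: "g \<in> generators E" and w: "set w \<subseteq> generators E" by auto
  have ctx: "mon (g # w) \<in> J" if "mon w \<in> J"
    using J_context[OF that, of "[g]" "[]"] g by simp
  have ctx': "mon (g # w) \<approx> mon (g # w')" if "mon w \<approx> mon w'" for w'
    using cong_context[OF that, of "[g]" "[]"] g by simp
  from cons.IH[OF w] show ?case
  proof
    assume "\<exists>w'\<in>(\<Union>u n. normal_words u n). mon w \<approx> mon w'"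
    then obtain \<alpha> v \<beta> u a where *: "awalk u \<alpha> v" "awalk a \<beta> v" "mon w \<approx> mon (normal_word \<alpha> v \<beta>)"
      by (auto elim: normal_wordsE)
    from normal_word_Cons[OF g *(1,2)] show ?thesis
    proof
      assume "mon (g # normal_word \<alpha> v \<beta>) \<in> J"
      then show ?thesis using cong_in[OF ctx'[OF *(3)]] by blast
    next
      assume "\<exists>w'\<in>(\<Union>u n. normal_words u n). mon (g # normal_word \<alpha> v \<beta>) \<approx> mon w'"
      then show ?thesis using cong_trans[OF ctx'[OF *(3)]] by meson
    qed
  qed (use ctx in blast)
qed

lemma normal_word_vertex:
  assumes "w \<in> normal_words u n" "x \<in> verts E"
  shows "x = u \<Longrightarrow> mon (w @ [Vertex x]) \<approx> mon w" and "x \<noteq> u \<Longrightarrow> mon (w @ [Vertex x]) \<in> J"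
proof -
  obtain \<alpha> v \<beta> a where w: "w = normal_word \<alpha> v \<beta>" "awalk a \<alpha> v" "awalk u \<beta> v"
    using assms(1) by (rule normal_wordsE)
  note G = awalk_gens[OF w(2)] awalk_gens[OF w(3)]
  have "(x = u \<longrightarrow> mon (w @ [Vertex x]) \<approx> mon w) \<and> (x \<noteq> u \<longrightarrow> mon (w @ [Vertex x]) \<in> J)"
  proof (cases \<beta>)
    case Nil
    then have "u = v" using w by (simp add: awalk_Nil_iff)
    have "x = u \<Longrightarrow> mon (map Edge \<alpha> @ [Vertex v, Vertex x] @ []) \<approx> mon (map Edge \<alpha> @ [Vertex v] @ [])"
      using G \<open>u = v\<close> rel_mon(1)[of v] by (intro cong_context) auto
    moreover have "x \<noteq> u \<Longrightarrow> mon (map Edge \<alpha> @ [Vertex v, Vertex x] @ []) \<in> J"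
      using G \<open>u = v\<close> assms by (intro J_context rel_mon) auto
    ultimately show ?thesis using Nil w by (simp add: normal_word_def)
  next
    case (Cons f \<beta>')
    then have f: "tail E f = u" "f \<in> arcs E" using w by (auto simp: awalk_Cons_iff)
    let ?p = "map Edge \<alpha> @ Vertex v # map Ghost (rev \<beta>')"
    have "x = u \<Longrightarrow> mon (?p @ [Ghost f, Vertex x] @ []) \<approx> mon (?p @ [Ghost f] @ [])"
      using G f rel_mon(6)[of f] Cons by (intro cong_context) auto
    moreover have "x \<noteq> u \<Longrightarrow> mon (?p @ [Ghost f, Vertex x] @ []) \<in> J"
      using G f assms Cons by (intro J_context rel_mon_mismatch) auto
    ultimately show ?thesis using Cons w by (simp add: normal_word_def)
  qed
  then show "x = u \<Longrightarrow> mon (w @ [Vertex x]) \<approx> mon w" "x \<noteq> u \<Longrightarrow> mon (w @ [Vertex x]) \<in> J"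
    by auto
qed

lemma normalize_keys:
  assumes "\<And>w. w \<in> Poly_Mapping.keys x \<Longrightarrow> mon w \<in> J \<or> (\<exists>w'\<in>S. mon w \<approx> mon w')"
  shows "\<exists>y. Poly_Mapping.keys y \<subseteq> S \<and> x \<approx> y"
proof -
  have "\<forall>w\<in>Poly_Mapping.keys x. \<exists>z. Poly_Mapping.keys z \<subseteq> S \<and> mon w \<approx> z"
  proof
    fix w assume "w \<in> Poly_Mapping.keys x"
    from assms[OF this] show "\<exists>z. Poly_Mapping.keys z \<subseteq> S \<and> mon w \<approx> z"
    proof
      assume "mon w \<in> J"
      then show ?thesis by (intro exI[of _ 0]) (simp add: cong_zero)
    next
      assume "\<exists>w'\<in>S. mon w \<approx> mon w'"
      then obtain w' where "w' \<in> S" "mon w \<approx> mon w'" by blast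
      then show ?thesis by (intro exI[of _ "mon w'"]) simp
    qed
  qed
  then obtain f where f: "\<And>w. w \<in> Poly_Mapping.keys x \<Longrightarrow> Poly_Mapping.keys (f w) \<subseteq> S \<and> mon w \<approx> f w"
    by metis
  let ?y = "\<Sum>w\<in>Poly_Mapping.keys x. scale (Poly_Mapping.lookup x w) (f w)"
  have "Poly_Mapping.keys ?y \<subseteq> (\<Union>w\<in>Poly_Mapping.keys x. Poly_Mapping.keys (scale (Poly_Mapping.lookup x w) (f w)))"
    by (rule keys_sum)
  also have "\<dots> \<subseteq> S" 
    by (rule UN_least, rule subset_trans[OF keys_scale], rule conjunct1[OF f])
  finally have "Poly_Mapping.keys ?y \<subseteq> S" .
  moreover have "x \<approx> ?y"
    by (subst mon_expand[of x], intro cong_sum cong_scale, rule conjunct2[OF f])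
  ultimately show ?thesis by (intro exI conjI)
qed

lemma normal_words_mono: "m \<le> n \<Longrightarrow> normal_words u m \<subseteq> normal_words u n"
  by (auto elim!: normal_wordsE intro!: normal_wordsI)

lemma normalizes:
  assumes "x \<in> acarrier (free_algebra E)"
  shows "\<exists>n y. Poly_Mapping.keys y \<subseteq> (\<Union>u. normal_words u n) \<and> x \<approx> y"
proof -
  have "\<exists>y. Poly_Mapping.keys y \<subseteq> (\<Union>u n. normal_words u n) \<and> x \<approx> y"
    by (rule normalize_keys, rule word_normalizes) (use assms in \<open>auto simp: free_algebra_def\<close>)
  then obtain y where y: "Poly_Mapping.keys y \<subseteq> (\<Union>u n. normal_words u n)" "x \<approx> y"
    by (elim exE conjE)
  have "\<forall>w\<in>Poly_Mapping.keys y. \<exists>m u. w \<in> normal_words u m"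
  proof
    fix w assume "w \<in> Poly_Mapping.keys y"
    then have "w \<in> (\<Union>u n. normal_words u n)" by (rule subsetD[OF y(1)])
    then show "\<exists>m u. w \<in> normal_words u m" by (elim UN_E) (intro exI)
  qed
  then obtain \<nu> where \<nu>: "\<And>w. w \<in> Poly_Mapping.keys y \<Longrightarrow> \<exists>u. w \<in> normal_words u (\<nu> w)"
    by (elim bchoice[elim_format] exE) (rule that, blast)
  define n where "n = Max (\<nu> ` Poly_Mapping.keys y)"
  have "Poly_Mapping.keys y \<subseteq> (\<Union>u. normal_words u n)"
  proof
    fix w assume w: "w \<in> Poly_Mapping.keys y"
    obtain u where "w \<in> normal_words u (\<nu> w)" using \<nu>[OF w] by (elim exE)
    moreover have "\<nu> w \<le> n" using w by (simp add: n_def)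
    ultimately have "w \<in> normal_words u n" using normal_words_mono subsetD by metis
    then show "w \<in> (\<Union>u. normal_words u n)" by (rule UN_I[OF UNIV_I])
  qed
  then show ?thesis using y(2) by (intro exI conjI)
qed

text \<open>
  An arc on the right cancels the last ghost arc, which is why it lowers the ghost length, or is
  appended to a word without ghost arcs.
\<close>
lemma normal_word_edge:
  assumes "w \<in> normal_words u (Suc n)" "e \<in> arcs E" "tail E e = u"
  shows "mon (w @ [Edge e]) \<in> J \<or> (\<exists>w'\<in>normal_words (head E e) n. mon (w @ [Edge e]) \<approx> mon w')"
proof -
  obtain \<alpha> v \<beta> a where w: "w = normal_word \<alpha> v \<beta>" "awalk a \<alpha> v" "awalk u \<beta> v" "length \<beta> \<le> Suc n"
    using assms(1) by (rule normal_wordsE)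
  note G = awalk_gens[OF w(2)] awalk_gens[OF w(3)]
  show ?thesis
  proof (cases \<beta>)
    case Nil
    then have "u = v" using w by (simp add: awalk_Nil_iff)
    have "mon (map Edge \<alpha> @ [Vertex v, Edge e] @ []) \<approx> mon (map Edge \<alpha> @ [Edge e] @ [])"
      using G \<open>u = v\<close> assms rel_mon(3)[of e] by (intro cong_context) auto
    also have "\<dots> \<approx> mon (map Edge \<alpha> @ [Edge e, Vertex (head E e)] @ [])"
      using G assms rel_mon(4)[of e] by (intro cong_sym[OF cong_context]) auto
    finally have "mon (w @ [Edge e]) \<approx> mon (normal_word (\<alpha> @ [e]) (head E e) [])"
      using Nil w(1) by (simp add: normal_word_def)
    moreover have "normal_word (\<alpha> @ [e]) (head E e) [] \<in> normal_words (head E e) n"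
      using w(2) assms \<open>u = v\<close> arc_implies_awalk[of e]
      by (intro normal_wordsI[of a]) (auto simp: awalk_append_iff awalk_Nil_iff)
    ultimately show ?thesis by blast
  next
    case (Cons f \<beta>')
    then have f: "f \<in> arcs E" "awalk (head E f) \<beta>' v" "length \<beta>' \<le> n"
      using w by (auto simp: awalk_Cons_iff)
    let ?p = "normal_word \<alpha> v \<beta>'"
    have p: "?p \<in> normal_words (head E f) n" using w(2) f by (intro normal_wordsI)
    have pg: "set ?p \<subseteq> generators E" using normal_word_gens[OF w(2) f(2)] .
    have wp: "w @ [Edge e] = ?p @ [Ghost f, Edge e] @ []" using w(1) Cons by (simp add: normal_word_def)
    show ?thesis
    proof (cases "f = e")
      case True
      have "mon (w @ [Edge e]) \<approx> mon (?p @ [Vertex (head E e)] @ [])"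
        using cong_context[OF rel_mon(7)[OF assms(2)] pg, of "[]"] wp True by simp
      moreover have p': "?p \<in> normal_words (head E e) n" using p True by simp
      then have "mon (?p @ [Vertex (head E e)]) \<approx> mon ?p"
        using assms(2) by (intro normal_word_vertex(1)) auto
      ultimately have "mon (w @ [Edge e]) \<approx> mon ?p" using cong_trans by simp
      with p' show ?thesis by (intro disjI2 bexI)
    next
      case False
      have "mon (w @ [Edge e]) \<in> J"
        unfolding wp using pg assms(2) f(1) False by (intro J_context rel_mon) auto
      then show ?thesis ..
    qed
  qed
qed

lemma normal_edge:
  assumes "Poly_Mapping.keys y \<subseteq> normal_words u (Suc n)" "e \<in> arcs E" "tail E e = u"
  shows "\<exists>z. Poly_Mapping.keys z \<subseteq> normal_words (head E e) n \<and> y * ed e \<approx> z"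
proof (rule normalize_keys)
  fix w assume "w \<in> Poly_Mapping.keys (y * ed e)"
  then have "w \<in> {a + b |a b. a \<in> Poly_Mapping.keys y \<and> b \<in> Poly_Mapping.keys (ed e :: ('v, 'e, 'k) free_elem)}"
    using keys_mult by (rule subsetD[rotated])
  then obtain w0 where w0: "w0 \<in> Poly_Mapping.keys y" "w = w0 @ [Edge e]"
    by (auto simp: plus_list_def)
  show "mon w \<in> J \<or> (\<exists>w'\<in>normal_words (head E e) n. mon w \<approx> mon w')"
    unfolding w0(2) using subsetD[OF assms(1) w0(1)] assms(2,3) by (rule normal_word_edge)
qed

lemma normal_words_vertex_in: "w \<in> normal_words u n \<Longrightarrow> u \<in> verts E"
  by (elim normal_wordsE) (rule awalk_hd_in_verts)

lemma normal_mult_vertex: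
  assumes "Poly_Mapping.keys y \<subseteq> normal_words u n" "u \<in> verts E"
  shows "y * vx u \<approx> y"
proof -
  have "y * vx u \<approx> y * 1"
  proof (rule cong_mult_expand)
    fix w assume "w \<in> Poly_Mapping.keys y"
    then have "mon (w @ [Vertex u]) \<approx> mon w"
      using assms(1) by (intro normal_word_vertex(1)[OF _ assms(2)]) (rule subsetD, auto)
    then show "mon w * vx u \<approx> mon w * 1" by (simp add: mon_append)
  qed
  then show ?thesis by simp
qed

text \<open>
  Multiplication by \<open>u\<close> on the right selects the terms that end at \<open>u\<close>, so these terms lie in every
  ideal that contains \<open>J\<close> and \<open>y\<close>.
\<close>
lemma normal_part:
  assumes "\<And>w. w \<in> Poly_Mapping.keys y \<Longrightarrow> w \<in> normal_words (\<rho> w) n" "u \<in> verts E"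
  shows "part (\<lambda>w. \<rho> w = u) y \<approx> y * vx u"
proof -
  let ?k = "Poly_Mapping.lookup y"
  have "y * vx u = (\<Sum>w\<in>Poly_Mapping.keys y. scale (?k w) (mon w * vx u))" by (rule mult_expand)
  also have "\<dots> \<approx> (\<Sum>w\<in>Poly_Mapping.keys y. if \<rho> w = u then scale (?k w) (mon w) else 0)"
  proof (rule cong_sum)
    fix w assume w: "w \<in> Poly_Mapping.keys y"
    have "mon w * vx u \<approx> mon w" if "\<rho> w = u"
      using normal_word_vertex(1)[OF assms(1)[OF w] assms(2)] that by (simp add: mon_append)
    moreover have "mon w * vx u \<in> J" if "\<rho> w \<noteq> u"
      using normal_word_vertex(2)[OF assms(1)[OF w] assms(2)] that by (simp add: mon_append)
    ultimately show "scale (?k w) (mon w * vx u) \<approx> (if \<rho> w = u then scale (?k w) (mon w) else 0)"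
      using cong_scale[of "mon w * vx u" "mon w" "?k w"] J_scale[of "mon w * vx u" "?k w"]
      by (cases "\<rho> w = u") (simp_all add: cong_zero)
  qed
  also have "\<dots> = part (\<lambda>w. \<rho> w = u) y"
    unfolding part_def by (subst sum.inter_filter[symmetric]) simp_all
  finally show ?thesis by (rule cong_sym)
qed

section \<open>Closed paths congruent to their base vertex\<close>

lemma vertex_absorb:
  assumes "awalk u \<alpha> v" "\<alpha> \<noteq> []"
  shows "mon (Vertex u # map Edge \<alpha>) \<approx> mon (map Edge \<alpha>)"
proof -
  obtain e \<alpha>' where \<alpha>: "\<alpha> = e # \<alpha>'" using assms(2) by (cases \<alpha>) auto
  then have "e \<in> arcs E" "u = tail E e" using assms(1) by (auto simp: awalk_Cons_iff)
  then have "mon ([] @ [Vertex u, Edge e] @ map Edge \<alpha>') \<approx> mon ([] @ [Edge e] @ map Edge \<alpha>')"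
    using awalk_gens[OF assms(1)] \<alpha> rel_mon(3)[of e] by (intro cong_context) auto
  then show ?thesis using \<alpha> by simp
qed

text \<open>
  If \<open>c = e c'\<close> is congruent to \<open>v\<close>, then \<open>c' e \<equiv> e\<^sup>* c e \<equiv> e\<^sup>* v e \<equiv> r(e)\<close>.
\<close>
lemma rotate1_closed:
  assumes "awalk v c v" "c \<noteq> []" "mon (map Edge c) \<approx> mon [Vertex v]"
  shows "\<exists>w. awalk w (rotate1 c) w \<and> mon (map Edge (rotate1 c)) \<approx> mon [Vertex w]"
proof -
  obtain e c' where c: "c = e # c'" using assms(2) by (cases c) auto
  then have e: "e \<in> arcs E" "v = tail E e" "awalk (head E e) c' v"
    using assms(1) by (auto simp: awalk_Cons_iff)
  then have aw: "awalk (head E e) (c' @ [e]) (head E e)"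
    using arc_implies_awalk[of e] by (auto simp: awalk_append_iff)
  have "mon (map Edge (c' @ [e])) \<approx> mon ([] @ [Vertex (head E e)] @ map Edge (c' @ [e]))"
    using vertex_absorb[OF aw] by (simp add: cong_sym)
  also have "\<dots> \<approx> mon ([] @ [Ghost e, Edge e] @ map Edge (c' @ [e]))"
    using awalk_gens[OF aw] e(1) by (intro cong_sym[OF cong_context] rel_mon) auto
  also have "\<dots> = mon ([Ghost e] @ map Edge c @ [Edge e])" using c by simp
  also have "\<dots> \<approx> mon ([Ghost e] @ [Vertex v] @ [Edge e])"
    using e(1) assms(3) by (intro cong_context) auto
  also have "\<dots> \<approx> mon [Ghost e, Edge e]"
    using cong_context[OF rel_mon(6)[OF e(1)], of "[]" "[Edge e]"] e by simp
  also have "\<dots> \<approx> mon [Vertex (head E e)]" using e(1) by (rule rel_mon)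
  finally show ?thesis using aw c by auto
qed

lemma rotate_closed:
  assumes "awalk v c v" "c \<noteq> []" "mon (map Edge c) \<approx> mon [Vertex v]"
  shows "\<exists>w. awalk w (rotate n c) w \<and> mon (map Edge (rotate n c)) \<approx> mon [Vertex w]"
proof (induction n)
  case (Suc n)
  then obtain w where "awalk w (rotate n c) w" "mon (map Edge (rotate n c)) \<approx> mon [Vertex w]" by blast
  from rotate1_closed[OF this(1) _ this(2)] show ?case using assms(2) by simp
qed (use assms in auto)

lemma power_closed:
  assumes "awalk u d u" "mon (map Edge d) \<approx> mon [Vertex u]"
  shows "mon (map Edge (concat (replicate m d)) @ [Vertex u]) \<approx> mon [Vertex u]"
proof (induction m)
  case (Suc m)
  note G = awalk_gens[OF assms(1)]
  have "mon (map Edge d @ (map Edge (concat (replicate m d)) @ [Vertex u]) @ []) \<approx> mon (map Edge d @ [Vertex u] @ [])"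
    using Suc G by (intro cong_context) auto
  also have "\<dots> \<approx> mon ([] @ [Vertex u] @ [Vertex u])"
    using cong_context[OF assms(2), of "[]" "[Vertex u]"] G by simp
  also have "\<dots> \<approx> mon [Vertex u]" using rel_mon(1)[of u] G by simp
  finally show ?case by simp
qed simp

section \<open>Combinations of words that kill a path\<close>

text \<open>
  If each word of \<open>z\<close> sends \<open>q\<close> to a single path, then the coefficient of a path in \<open>z q\<close> is the sum of
  the coefficients of the words leading to it.  When those words are congruent to each other, \<open>z\<close> is
  congruent to a combination with these vanishing sums as coefficients.
\<close>
lemma coefficients_vanish:
  assumes g: "\<And>w. w \<in> Poly_Mapping.keys z \<Longrightarrow>
      word_action E w (Poly_Mapping.single q (1::'k)) = Poly_Mapping.single (g w) 1"
    and sep: "\<And>w w'. w \<in> Poly_Mapping.keys z \<Longrightarrow> w' \<in> Poly_Mapping.keys z \<Longrightarrow> g w = g w' \<Longrightarrow> mon w \<approx> mon w'"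
    and zero: "free_action E z (Poly_Mapping.single q 1) = 0"
  shows "z \<in> J"
proof -
  let ?k = "Poly_Mapping.lookup z" and ?K = "Poly_Mapping.keys z"
  have act: "free_action E z (Poly_Mapping.single q 1) = (\<Sum>w\<in>?K. Poly_Mapping.single (g w) (?k w))"
    unfolding free_action_def linear_extension_def using g by (intro sum.cong) simp_all
  have coeff: "(\<Sum>w | w \<in> ?K \<and> g w = x. ?k w) = 0" for x
  proof -
    have "(\<Sum>w | w \<in> ?K \<and> g w = x. ?k w) = (\<Sum>w\<in>?K. if g w = x then ?k w else 0)"
      by (subst sum.inter_filter[symmetric]) simp_all
    also have "\<dots> = Poly_Mapping.lookup (\<Sum>w\<in>?K. Poly_Mapping.single (g w) (?k w)) x"
      unfolding lookup_sum by (intro sum.cong) (auto simp: lookup_single when_def)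
    also have "\<dots> = 0" using zero act by simp
    finally show ?thesis .
  qed
  \<comment> \<open>\<open>r x\<close> represents all words that send \<open>q\<close> to \<open>x\<close>\<close>
  define r where "r x = (SOME w. w \<in> ?K \<and> g w = x)" for x
  have r: "r (g w) \<in> ?K \<and> g (r (g w)) = g w" if "w \<in> ?K" for w
    unfolding r_def by (rule someI[of _ w]) (use that in simp)
  have "z = (\<Sum>w\<in>?K. scale (?k w) (mon w))" by (rule mon_expand)
  also have "\<dots> \<approx> (\<Sum>w\<in>?K. scale (?k w) (mon (r (g w))))"
    using r sep by (intro cong_sum cong_scale) metis
  also have "\<dots> = (\<Sum>x\<in>g ` ?K. \<Sum>w | w \<in> ?K \<and> g w = x. scale (?k w) (mon (r (g w))))"
    by (rule sum.image_gen) simp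
  also have "\<dots> = (\<Sum>x\<in>g ` ?K. scale (\<Sum>w | w \<in> ?K \<and> g w = x. ?k w) (mon (r x)))"
    unfolding scale_sum_left by (intro sum.cong) auto
  also have "\<dots> = 0" unfolding coeff by simp
  finally show ?thesis by (simp add: cong_zero)
qed

end

section \<open>Periodic infinite words\<close>

lemma stream_eqI: "(\<And>n. s !! n = t !! n) \<Longrightarrow> s = t"
  using smap_alt[of id s t] by (simp add: stream.map_id)

lemma shift_fixpoint:
  assumes "q = \<gamma> @- q" "\<gamma> \<noteq> []"
  shows "q = Stream.cycle \<gamma>"
proof (rule stream_eqI)
  fix n
  have c: "Stream.cycle \<gamma> = \<gamma> @- Stream.cycle \<gamma>" by (rule cycle_decomp) fact
  show "q !! n = Stream.cycle \<gamma> !! n"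
  proof (induction n rule: less_induct)
    case (less n)
    have "q !! n = (\<gamma> @- q) !! n" "Stream.cycle \<gamma> !! n = (\<gamma> @- Stream.cycle \<gamma>) !! n"
      using assms(1) c by simp_all
    moreover have "\<not> n < length \<gamma> \<Longrightarrow> n - length \<gamma> < n" using assms(2) by (cases \<gamma>) auto
    ultimately show ?case using less[of "n - length \<gamma>"] by (auto simp: shift_snth)
  qed
qed

lemma shift_eq_shift:
  assumes "\<alpha> @- q = \<beta> @- q" "\<alpha> \<noteq> \<beta>" "length \<alpha> \<le> length \<beta>"
  obtains \<gamma> where "\<beta> = \<alpha> @ \<gamma>" "\<gamma> \<noteq> []" "q = \<gamma> @- q"
proof
  let ?\<gamma> = "drop (length \<alpha>) \<beta>"
  have "take (length \<alpha>) \<beta> = \<alpha>"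
    using arg_cong[OF assms(1), of "stake (length \<alpha>)"] assms(3) by (simp add: stake_shift)
  then show "\<beta> = \<alpha> @ ?\<gamma>" by (metis append_take_drop_id)
  with assms(2) show "?\<gamma> \<noteq> []" by auto
  show "q = ?\<gamma> @- q"
    using arg_cong[OF assms(1), of "sdrop (length \<alpha>)"] assms(3) by (simp add: sdrop_shift)
qed

text \<open>
  A coincidence \<open>\<alpha>q = \<beta>q\<close> between distinct finite words determines \<open>q\<close>, as the periodic word whose
  period is the overhang of the longer one; so finitely many words have finitely many bad \<open>q\<close>.
\<close>
lemma infinite_separates:
  assumes "infinite Q" "finite A"
  shows "\<exists>q\<in>Q. inj_on (\<lambda>\<alpha>. \<alpha> @- q) A"
proof -
  let ?B = "(\<lambda>(\<alpha>, \<beta>). Stream.cycle (drop (length \<alpha>) \<beta>)) ` (A \<times> A)"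
  have "finite ?B" using assms(2) by simp
  then obtain q where q: "q \<in> Q" "q \<notin> ?B"
    using assms(1) by (meson finite_subset subsetI)
  have *: "\<alpha> = \<beta>" if "\<alpha> \<in> A" "\<beta> \<in> A" "\<alpha> @- q = \<beta> @- q" "length \<alpha> \<le> length \<beta>" for \<alpha> \<beta>
  proof (rule ccontr)
    assume "\<alpha> \<noteq> \<beta>"
    from that(3) this that(4) obtain \<gamma> where "\<beta> = \<alpha> @ \<gamma>" "\<gamma> \<noteq> []" "q = \<gamma> @- q"
      by (rule shift_eq_shift)
    then have "q = Stream.cycle (drop (length \<alpha>) \<beta>)" using shift_fixpoint[of q \<gamma>] by simp
    with that q show False by auto
  qed
  have "inj_on (\<lambda>\<alpha>. \<alpha> @- q) A"
    by (rule inj_onI) (metis * nle_le)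
  with q show ?thesis by blast
qed

lemma sdrop_period:
  assumes "sdrop L q = q" shows "sdrop (n * L) q = q"
proof (induction n)
  case (Suc n)
  have "sdrop (Suc n * L) q = sdrop (n * L) (sdrop L q)" by (simp only: sdrop_add mult_Suc)
  with Suc assms show ?case by simp
qed simp

lemma snth_period:
  assumes "sdrop L q = q" shows "q !! (i + n * L) = q !! i"
  using sdrop_snth[of "n * L" q i] sdrop_period[OF assms] by (simp add: add.commute)

lemma fixpoint_sdrop: "q = \<gamma> @- q \<Longrightarrow> sdrop (length \<gamma>) q = q"
proof -
  assume "q = \<gamma> @- q"
  moreover have "sdrop (length \<gamma>) (\<gamma> @- q) = q" by (simp add: sdrop_shift)
  ultimately show ?thesis by simp
qed

text \<open>
  Since \<open>d\<close> has no repetition, the word \<open>d\<^sup>\<infinity>\<close> agrees with a shift of itself only if the shift is a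
  multiple of the length of \<open>d\<close>.
\<close>
lemma period_of_cycle:
  assumes "Stream.cycle d = \<gamma> @- Stream.cycle d" "d \<noteq> []" "distinct d"
  shows "\<exists>m. \<gamma> = concat (replicate m d)"
proof -
  let ?L = "length \<gamma>" and ?k = "length \<gamma> mod length d"
  have "sdrop ?L (Stream.cycle d) = Stream.cycle d" using assms(1) by (rule fixpoint_sdrop)
  then have "Stream.cycle (rotate ?k d) = Stream.cycle d" using assms(2) by (simp add: sdrop_cycle)
  then have "shd (Stream.cycle (rotate ?k d)) = shd (Stream.cycle d)" by simp
  then have "hd (rotate ?k d) = hd d" by simp
  then have "d ! ?k = d ! 0"
    using assms(2) hd_rotate_conv_nth[of d ?k] by (simp add: hd_conv_nth)
  moreover have "?k < length d" "0 < length d" using assms(2) by auto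
  ultimately have "?k = 0" using assms(3) nth_eq_iff_index_eq by blast
  then have "stake ?L (Stream.cycle d) = concat (replicate (?L div length d) d)"
    using assms(2) by simp
  moreover have "stake ?L (Stream.cycle d) = \<gamma>"
    by (subst assms(1)) (simp add: stake_shift)
  ultimately show ?thesis by auto
qed

section \<open>The tail-equivalence class of an infinite path\<close>

locale path_class = wf_digraph E for E :: "('v, 'e) pre_digraph" +
  fixes p :: "'e stream"
  assumes ip: "infinite_path E p"
begin

declare awalkE [rule del]

lemma p_in_class: "p \<in> tail_class E p"
  using ip by (auto simp: tail_class_def tail_equivalent_def)

lemma sdrop_in_class: "q \<in> tail_class E p \<Longrightarrow> sdrop n q \<in> tail_class E p"
  by (induction n arbitrary: q) (auto intro: tc_stl)

lemma class_arcs: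
  assumes "q \<in> tail_class E p"
  shows "q !! n \<in> arcs E" "head E (q !! n) = tail E (q !! Suc n)"
  using assms unfolding tail_class_def infinite_path_def by blast+

lemma awalk_stake:
  assumes "q \<in> tail_class E p"
  shows "awalk (tail E (shd q)) (stake n q) (tail E (q !! n))"
  using assms
proof (induction n arbitrary: q)
  case 0
  then show ?case using class_arcs(1)[of q 0] by (simp add: awalk_Nil_iff)
next
  case (Suc n)
  have "tail E (shd (stl q)) = head E (shd q)" using class_arcs(2)[OF Suc.prems, of 0] by simp
  then show ?case
    using Suc.IH[OF tc_stl[OF Suc.prems]] class_arcs(1)[OF Suc.prems, of 0] by (simp add: awalk_Cons_iff)
qed

lemma class_reachable:
  assumes "q \<in> tail_class E p" "m \<le> n"
  shows "reachable E (tail E (q !! m)) (tail E (q !! n))"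
  using awalk_stake[OF sdrop_in_class[OF assms(1)], of m "n - m"] assms(2)
  by (auto simp: reachable_awalk sdrop_snth)

lemma not_in_H_iff:
  "v \<in> verts E - path_H E p \<longleftrightarrow> v \<in> verts E \<and> (\<exists>n. reachable E v (tail E (p !! n)))"
  by (auto simp: path_H_def sset_range)

lemma not_in_H_back:
  assumes "reachable E u v" "v \<in> verts E - path_H E p"
  shows "u \<in> verts E - path_H E p"
  using assms unfolding not_in_H_iff by (meson reachable_trans reachable_in_verts(1))

lemma class_not_in_H:
  assumes "q \<in> tail_class E p"
  shows "tail E (q !! n) \<in> verts E - path_H E p"
proof -
  obtain i j where ij: "sdrop i p = sdrop j q"
    using assms by (auto simp: tail_class_def tail_equivalent_def)
  then have "q !! (j + n) = p !! (i + n)" by (metis sdrop_snth)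
  moreover have "reachable E (tail E (q !! n)) (tail E (q !! (j + n)))"
    using assms by (rule class_reachable) simp
  ultimately show ?thesis
    unfolding not_in_H_iff using reachable_in_verts(1) by metis
qed

definition paths_from :: "'v \<Rightarrow> 'e stream set" where
  "paths_from u = {q \<in> tail_class E p. tail E (shd q) = u}"

lemma shift_paths_from:
  assumes "awalk u \<alpha> w" "q \<in> paths_from w"
  shows "\<alpha> @- q \<in> paths_from u"
  using assms
proof (induction \<alpha> arbitrary: u)
  case (Cons e \<alpha>)
  then have "e \<in> arcs E" "u = tail E e" "\<alpha> @- q \<in> paths_from (head E e)"
    by (auto simp: awalk_Cons_iff)
  then show ?case by (auto simp: paths_from_def intro: tc_SCons)
qed (simp add: awalk_Nil_iff)

lemma paths_from_nonempty:
  assumes "u \<in> verts E - path_H E p"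
  shows "\<exists>q. q \<in> paths_from u"
proof -
  obtain n \<alpha> where "awalk u \<alpha> (tail E (p !! n))"
    using assms unfolding not_in_H_iff reachable_awalk by blast
  moreover have "sdrop n p \<in> paths_from (tail E (p !! n))"
    using sdrop_in_class[OF p_in_class] by (simp add: paths_from_def)
  ultimately show ?thesis using shift_paths_from by blast
qed

lemma paths_from_SCons:
  assumes "e \<in> arcs E" "head E e \<notin> path_H E p"
  shows "\<exists>q. e ## q \<in> paths_from (tail E e)"
proof -
  obtain q where "q \<in> paths_from (head E e)" using paths_from_nonempty[of "head E e"] assms head_in_verts by blast
  then show ?thesis using shift_paths_from[of "tail E e" "[e]" "head E e" q] arc_implies_awalk[OF assms(1)]
    by auto
qed

section \<open>Exclusive cycles and the paths of the class\<close>

text \<open>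
  No arc branches off \<open>q\<close> and still leads back to \<open>p\<close>.  Such a path is determined by its first vertex.
\<close>
definition no_exit :: "'e stream \<Rightarrow> bool" where
  "no_exit q \<longleftrightarrow>
    (\<forall>i. \<forall>e\<in>arcs E. tail E e = tail E (q !! i) \<longrightarrow> head E e \<notin> path_H E p \<longrightarrow> e = q !! i)"

text \<open>
  From a periodic path one may run through the period any number of times before taking an exit.
  An exit from which \<open>p\<close> can be reached would thus give infinitely many paths of the class.
\<close>
lemma finite_paths_no_exit:
  assumes fin: "finite (paths_from u)" and q: "q \<in> paths_from u" and per: "sdrop L q = q" "L > 0"
  shows "no_exit q"
  unfolding no_exit_def
proof (intro allI ballI impI, rule ccontr)
  fix i e
  assume e: "e \<in> arcs E" "tail E e = tail E (q !! i)" "head E e \<notin> path_H E p" and ne: "e \<noteq> q !! i"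
  obtain q' where q': "e ## q' \<in> paths_from (tail E e)" using paths_from_SCons e by blast
  have qc: "q \<in> tail_class E p" "tail E (shd q) = u" using q by (auto simp: paths_from_def)
  define r where "r n = stake (i + n * L) q @- e ## q'" for n
  have "r n \<in> paths_from u" for n
  proof -
    have "q !! (i + n * L) = q !! i" using per(1) by (rule snth_period)
    then have "awalk u (stake (i + n * L) q) (tail E e)"
      using awalk_stake[OF qc(1), of "i + n * L"] qc(2) e(2) by simp
    then show ?thesis unfolding r_def using q' by (rule shift_paths_from)
  qed
  moreover have "inj r"
  proof (rule linorder_injI)
    fix m n :: nat assume "m < n"
    then have "i + m * L < i + n * L" using per(2) by simp
    then have "r n !! (i + m * L) = q !! i"
      using snth_period[OF per(1), of i m] by (simp add: r_def)
    moreover have "r m !! (i + m * L) = e" by (simp add: r_def)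
    ultimately show "r m \<noteq> r n" using ne by metis
  qed
  ultimately show False using fin
    by (metis finite_subset image_subsetI infinite_UNIV_nat finite_imageD)
qed

lemma no_exit_awalk:
  assumes q: "q \<in> tail_class E p" "no_exit q"
    and "awalk (tail E (q !! i)) d w" "w \<notin> path_H E p"
  shows "d = stake (length d) (sdrop i q) \<and> w = tail E (q !! (i + length d))"
  using assms(3)
proof (induction d arbitrary: i)
  case Nil then show ?case by (simp add: awalk_Nil_iff)
next
  case (Cons e d)
  then have e: "e \<in> arcs E" "tail E (q !! i) = tail E e" "awalk (head E e) d w"
    by (auto simp: awalk_Cons_iff)
  have "w \<in> verts E - path_H E p" using assms(4) awalk_last_in_verts[OF e(3)] by simp
  then have "head E e \<notin> path_H E p"
    using not_in_H_back[of "head E e" w] e(3) reachable_awalk by blast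
  then have ei: "e = q !! i" using q(2) e unfolding no_exit_def by metis
  then have "head E e = tail E (q !! Suc i)" using class_arcs(2)[OF q(1)] by simp
  with Cons.IH[of "Suc i"] e(3) ei show ?case by (simp del: sdrop.simps)
qed

lemma no_exit_tail_eq:
  assumes q: "q \<in> tail_class E p" "no_exit q" and eq: "tail E (q !! i) = tail E (q !! j)"
  shows "sdrop i q = sdrop j q"
proof (rule stream_eqI)
  fix n
  have "awalk (tail E (q !! i)) (stake (Suc n) (sdrop j q)) (tail E (q !! (j + Suc n)))"
    using awalk_stake[OF sdrop_in_class[OF q(1)], of j "Suc n"] eq by (simp add: sdrop_snth del: stake.simps)
  then have "stake (Suc n) (sdrop j q) = stake (Suc n) (sdrop i q)"
    using no_exit_awalk[OF q] class_not_in_H[OF q(1)] by (metis DiffD2 length_stake)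
  then show "sdrop i q !! n = sdrop j q !! n" by (metis lessI stake_nth)
qed

text \<open>
  On a path without exits the vertex determines the continuation.  Hence the shortest return to the
  first vertex repeats no vertex, and any cycle through one of its vertices, whose vertices all
  reach \<open>p\<close>, has to follow it.
\<close>
lemma no_exit_exclusive:
  assumes q: "q \<in> tail_class E p" "no_exit q" and per: "sdrop L q = q" "L > 0"
  shows "\<exists>v c. exclusive_cycle_at E v c \<and> ends_in_cycle p c"
proof -
  define P where "P k \<longleftrightarrow> k > 0 \<and> tail E (q !! k) = tail E (q !! 0)" for k
  define k where "k = (LEAST k. P k)"
  have "P L" using per by (metis P_def add_0 mult_1 snth_period)
  then have k: "k > 0" "tail E (q !! k) = tail E (q !! 0)" using LeastI[of P L] by (auto simp: k_def P_def)
  have least: "k \<le> j" if "j > 0" "tail E (q !! j) = tail E (q !! 0)" for j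
    using that by (auto simp: k_def P_def intro: Least_le)
  have kper: "sdrop k q = q" using no_exit_tail_eq[OF q k(2)] by simp
  define d where "d = stake k q"
  have d: "d \<noteq> []" "length d = k" using k by (auto simp: d_def)
  have "q = d @- q" using stake_sdrop[of k q] kper by (simp add: d_def)
  then have qd: "q = Stream.cycle d" using d(1) by (rule shift_fixpoint)
  have "distinct (map (tail E) d)"
  proof -
    have *: False if "i < j" "j < k" "tail E (q !! i) = tail E (q !! j)" for i j
    proof -
      have "sdrop i q = sdrop j q" using no_exit_tail_eq[OF q that(3)] .
      then have "q !! (i + (k - j)) = q !! (j + (k - j))" by (metis sdrop_snth)
      with k(2) that have "tail E (q !! (i + (k - j))) = tail E (q !! 0)" by simp
      with least[of "i + (k - j)"] that show False by simp
    qed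
    show ?thesis
      unfolding distinct_conv_nth
    proof (intro allI impI)
      fix i j assume "i < length (map (tail E) d)" "j < length (map (tail E) d)" "i \<noteq> j"
      then show "map (tail E) d ! i \<noteq> map (tail E) d ! j"
        using *[of i j] *[of j i] by (auto simp: d_def neq_iff)
    qed
  qed
  then have "cycle_at E (tail E (shd q)) d"
    using awalk_stake[OF q(1), of k] k(2) d by (simp add: cycle_at_def d_def)
  moreover have "\<exists>n. d' = rotate n d" if w: "w \<in> tail E ` set d" and d': "cycle_at E w d'" for w d'
  proof -
    obtain i where i: "i < k" "w = tail E (q !! i)" using w d(2) by (auto simp: in_set_conv_nth d_def)
    let ?l = "length d'"
    have l: "?l > 0" and dist: "distinct (map (tail E) d')" and aw: "awalk (tail E (q !! i)) d' w"
      using d' i by (auto simp: cycle_at_def)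
    have "w \<notin> path_H E p" using class_not_in_H[OF q(1)] i by simp
    from no_exit_awalk[OF q aw this]
    have d'q: "d' = stake ?l (sdrop i q)" and "tail E (q !! (i + ?l)) = tail E (q !! i)" using i by auto
    then have "sdrop (i + ?l) q = sdrop i q" using no_exit_tail_eq[OF q] by blast
    then have "q !! (i + ?l + (k - i)) = q !! (i + (k - i))" by (metis sdrop_snth)
    moreover have "q !! (?l + k) = q !! ?l" using snth_period[OF kper, of ?l 1] by simp
    ultimately have "q !! ?l = q !! k" using i(1) by (simp add: add.commute)
    then have "k \<le> ?l" using least[of ?l] k l by simp
    moreover have "\<not> k < ?l"
    proof
      assume "k < ?l"
      have "d' ! j = q !! (i + j)" if "j < ?l" for j
        using that d'q by (metis sdrop_snth stake_nth)
      from this[OF l] this[OF \<open>k < ?l\<close>] have "d' ! 0 = d' ! k"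
        using snth_period[OF kper, of i 1] by simp
      then have "map (tail E) d' ! 0 = map (tail E) d' ! k"
        using l \<open>k < ?l\<close> by (metis nth_map)
      then show False
        using nth_eq_iff_index_eq[OF dist, of 0 k] l k(1) \<open>k < ?l\<close> by (metis length_map less_irrefl)
    qed
    ultimately have "?l = k" by simp
    have "sdrop i q = Stream.cycle (rotate i d)"
      using sdrop_cycle[OF d(1), of i] i(1) d(2) unfolding qd[symmetric] by simp
    with d'q have "d' = stake k (Stream.cycle (rotate i d))" unfolding \<open>?l = k\<close> by simp
    also have "\<dots> = rotate i d" using stake_cycle_eq[of "rotate i d"] d by simp
    finally show ?thesis by blast
  qed
  moreover have "ends_in_cycle p d" using q(1) qd by (auto simp: ends_in_cycle_def tail_class_def)
  ultimately show ?thesis unfolding exclusive_cycle_at_def by blast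
qed

lemma ends_in_cycle_sdrop:
  assumes "q \<in> tail_class E p" "ends_in_cycle p c"
  obtains m n where "sdrop m q = sdrop n (Stream.cycle c)"
proof -
  obtain i j where 1: "sdrop i p = sdrop j q"
    using assms by (auto simp: tail_class_def tail_equivalent_def)
  obtain a b where 2: "sdrop a p = sdrop b (Stream.cycle c)"
    using assms by (auto simp: ends_in_cycle_def tail_equivalent_def)
  have "sdrop (j + a) q = sdrop a (sdrop i p)" using 1 by simp
  also have "\<dots> = sdrop i (sdrop a p)" by (simp add: add.commute)
  also have "\<dots> = sdrop (b + i) (Stream.cycle c)" using 2 by simp
  finally show ?thesis by (rule that)
qed

text \<open>
  A periodic path can be read off arbitrarily far out, where it coincides with \<open>c\<^sup>\<infinity>\<close>.
\<close>
lemma periodic_is_rotation: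
  assumes q: "q \<in> tail_class E p" "sdrop L q = q" "L > 0" and c: "ends_in_cycle p c" "c \<noteq> []"
  shows "\<exists>n. q = Stream.cycle (rotate n c)"
proof -
  obtain m n where "sdrop m q = sdrop n (Stream.cycle c)"
    using q(1) c(1) by (rule ends_in_cycle_sdrop)
  then have "sdrop (m * L - m) (sdrop m q) = sdrop (n + (m * L - m)) (Stream.cycle c)" by simp
  moreover have "m + (m * L - m) = m * L" using q(3) by (cases L) auto
  ultimately have "q = sdrop (n + (m * L - m)) (Stream.cycle c)"
    using sdrop_period[OF q(2), of m] by simp
  then show ?thesis using c(2) sdrop_cycle by metis
qed

text \<open>
  A simple path from the head of \<open>e\<close> back to its tail closes up with \<open>e\<close> to a cycle, which
  exclusivity identifies with a rotation of \<open>c\<close>.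
\<close>
lemma exclusive_arc:
  assumes c: "exclusive_cycle_at E v c" and w: "tail E e \<in> tail E ` set c"
    and e: "e \<in> arcs E" "reachable E (head E e) (tail E e)"
  shows "e \<in> set c"
proof -
  obtain \<pi> where "apath (head E e) \<pi> (tail E e)" using e(2) reachable_apath by blast
  then have \<pi>: "awalk (head E e) \<pi> (tail E e)" "distinct (awalk_verts (head E e) \<pi>)"
    by (auto simp: apath_def)
  have "distinct (map (tail E) (e # \<pi>))"
  proof (cases "\<pi> = []")
    case False
    then have "awalk_verts (head E e) \<pi> = map (tail E) \<pi> @ [head E (last \<pi>)]"
      by (simp add: awalk_verts_conv)
    moreover have "head E (last \<pi>) = tail E e"
      using \<pi>(1) calculation by (auto dest: awlast_of_awalk)
    ultimately show ?thesis using \<pi>(2) by auto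
  qed simp
  then have "cycle_at E (tail E e) (e # \<pi>)"
    using \<pi> e by (simp add: cycle_at_def awalk_Cons_iff)
  then obtain n where "e # \<pi> = rotate n c" using c w unfolding exclusive_cycle_at_def by blast
  then show ?thesis by (metis list.set_intros(1) set_rotate)
qed

text \<open>
  A path of the class that starts on \<open>c\<close> returns to \<open>c\<close> in the end, so by exclusivity it never
  leaves \<open>c\<close>.
\<close>
lemma exclusive_paths_from:
  assumes c: "exclusive_cycle_at E v c" "ends_in_cycle p c" and q: "q \<in> paths_from v"
  shows "q = Stream.cycle c"
proof -
  let ?x = "Stream.cycle c" and ?L = "length c"
  have qc: "q \<in> tail_class E p" "tail E (shd q) = v" using q by (auto simp: paths_from_def)
  have cyc: "awalk v c v" "c \<noteq> []" "distinct (map (tail E) c)"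
    using c(1) by (auto simp: exclusive_cycle_at_def cycle_at_def)
  then have L: "?L > 0" and per: "sdrop ?L ?x = ?x" by auto
  obtain m n where mn: "sdrop m q = sdrop n ?x" using qc(1) c(2) by (rule ends_in_cycle_sdrop)
  have x_in: "?x !! i \<in> set c" for i using cyc snth_sset sset_cycle by metis
  \<comment> \<open>moving on from position \<open>n\<close> of \<open>c\<^sup>\<infinity>\<close> to position \<open>n * ?L\<close> reaches a multiple of the period\<close>
  let ?N = "m + (n * ?L - n)"
  have "sdrop ?N q = sdrop (n * ?L - n) (sdrop m q)" by (simp only: sdrop_add)
  also have "\<dots> = sdrop (n * ?L - n) (sdrop n ?x)" by (simp only: mn)
  also have "\<dots> = sdrop (n * ?L) ?x" using L by (simp only: sdrop_add) (cases ?L; simp)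
  also have "\<dots> = ?x" using per by (rule sdrop_period)
  finally have N: "sdrop ?N q = ?x" .
  then have xc: "?x \<in> tail_class E p" using sdrop_in_class[OF qc(1)] by metis
  have step: "q !! i = ?x !! i" if eq: "tail E (q !! i) = tail E (?x !! i)" for i
  proof -
    have "reachable E (head E (q !! i)) (tail E (q !! (?N + Suc i)))"
      using class_reachable[OF qc(1), of "Suc i" "?N + Suc i"] class_arcs(2)[OF qc(1), of i] by simp
    also have "tail E (q !! (?N + Suc i)) = tail E (?x !! Suc i)" using N by (metis sdrop_snth)
    also have "reachable E \<dots> (tail E (?x !! (i + Suc i * ?L)))"
      using xc by (rule class_reachable) (use L in \<open>cases ?L; simp\<close>)
    also have "?x !! (i + Suc i * ?L) = ?x !! i" using per by (rule snth_period)
    finally have "q !! i \<in> set c"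
      using exclusive_arc[OF c(1), of "q !! i"] eq x_in[of i] class_arcs(1)[OF qc(1)] by simp
    then show ?thesis
      using eq x_in[of i] cyc(3) inj_onD[of "tail E" "set c" "q !! i" "?x !! i"] by (simp add: distinct_map)
  qed
  show ?thesis
  proof (rule stream_eqI)
    fix i show "q !! i = ?x !! i"
    proof (rule step, induction i)
      case 0
      have "?x !! 0 = hd c" using cyc(2) by simp
      then show ?case using cyc qc(2) by (cases c) (auto simp: awalk_Cons_iff)
    next
      case (Suc i)
      then show ?case using step[of i] class_arcs(2)[OF qc(1), of i] class_arcs(2)[OF xc, of i] by simp
    qed
  qed
qed

lemma annihilator_leavitt_ideal:
  "leavitt_ideal E (free_annihilator E p :: ('v, 'e, 'k::field) free_elem set)"
  by unfold_locales (rule kills_ideal, rule relators_kills, rule wf_digraph)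

lemma word_action_path:
  assumes "awalk a \<alpha> u" "q \<in> paths_from u"
  shows "word_action E (map Edge \<alpha> @ [Vertex u]) (Poly_Mapping.single q (1::'k::field)) =
    Poly_Mapping.single (\<alpha> @- q) 1"
  using assms(1)
proof (induction \<alpha> arbitrary: a)
  case Nil
  then show ?case using assms(2) by (simp add: paths_from_def)
next
  case (Cons e \<alpha>)
  then have "awalk (head E e) \<alpha> u" by (simp add: awalk_Cons_iff)
  moreover from shift_paths_from[OF this assms(2)] have "head E e = tail E (shd (\<alpha> @- q))"
    by (simp add: paths_from_def)
  ultimately show ?case using Cons.IH by simp
qed

end

section \<open>Annihilating elements lie in the ideal\<close>

text \<open>
  The properties of the preimage in the free algebra of either of the two ideals in question.
  The two parts of the statement differ only in how they satisfy the condition on exclusive cycles: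
  it is vacuous in the first part.
\<close>
locale chen_ideal = path_class E p + leavitt_ideal E J
  for E :: "('v, 'e) pre_digraph" and p and J :: "('v, 'e, 'k::field) free_elem set" +
  assumes H_in: "v \<in> path_H E p \<Longrightarrow> vx v \<in> J"
    and breaking_in: "u \<in> breaking_vertices E (path_H E p) \<Longrightarrow> breaking_elem E (path_H E p) u \<in> J"
    and cycle_in: "\<exists>v c. exclusive_cycle_at E v c \<and> ends_in_cycle p c \<Longrightarrow>
      \<exists>v c. exclusive_cycle_at E v c \<and> ends_in_cycle p c \<and> cycle_minus_vertex v c \<in> J"
    and J_annihilates: "J \<subseteq> free_annihilator E p"
begin

abbreviation live_arcs :: "'v \<Rightarrow> 'e set" where
  "live_arcs u \<equiv> {e \<in> out_arcs E u. head E e \<notin> path_H E p}"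

lemmas ann_diff = leavitt_ideal.J_diff[OF annihilator_leavitt_ideal]
  and ann_mult_right = leavitt_ideal.J_mult_right[OF annihilator_leavitt_ideal]
  and ann_carrier = leavitt_ideal.J_carrier[OF annihilator_leavitt_ideal]

lemma cong_annihilator:
  assumes "x \<approx> y" "x \<in> free_annihilator E p" shows "y \<in> free_annihilator E p"
  using ann_diff[OF assms(2), of "x - y"] assms(1) J_annihilates by (auto simp: cong_def)

lemma annihilator_act:
  "y \<in> free_annihilator E p \<Longrightarrow> q \<in> paths_from u \<Longrightarrow> free_action E y (Poly_Mapping.single q (1::'k)) = 0"
  by (auto simp: free_annihilator_def paths_from_def intro: cm_single)

lemma dead_arc:
  assumes "e \<in> arcs E" "head E e \<in> path_H E p" shows "ed e * gh e \<in> J"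
proof -
  have "ed e * vx (head E e) \<in> J" using assms fc_gen by (intro J_mult_left H_in)
  then have "ed e \<in> J"
    using rel_mon(4)[OF assms(1)] cong_in[OF cong_sym, of "ed e * vx (head E e)" "ed e"]
    by (simp add: mon_append[symmetric])
  then show ?thesis using assms fc_gen by (intro J_mult_right)
qed

text \<open>
  A live vertex emits a live arc, so with finitely many live arcs it is either regular or a breaking
  vertex.  In the first case the arcs into \<open>H\<close> drop out of the relation at \<open>u\<close>, in the second the
  equation says that the breaking element lies in \<open>J\<close>.
\<close>
lemma live_vertex_sum:
  assumes u: "u \<in> verts E - path_H E p" and fin: "finite (live_arcs u)"
  shows "vx u \<approx> (\<Sum>e\<in>live_arcs u. ed e * gh e)"
proof -
  obtain q where "q \<in> paths_from u" using u paths_from_nonempty by blast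
  then have "q !! 0 \<in> live_arcs u"
    using class_arcs[of q 0] class_not_in_H[of q "Suc 0"] by (auto simp: paths_from_def)
  then have ne: "live_arcs u \<noteq> {}" by blast
  show ?thesis
  proof (cases "finite (out_arcs E u)")
    case True
    then have "regular E u" using u ne by (auto simp: regular_def)
    from subsetD[OF relators_in relators.intros(9)[OF this]]
    have "vx u \<approx> (\<Sum>e\<in>out_arcs E u. ed e * gh e)" by (simp add: cong_def)
    also have "\<dots> = (\<Sum>e\<in>live_arcs u. ed e * gh e) + (\<Sum>e\<in>out_arcs E u - live_arcs u. ed e * gh e)"
      by (simp only: sum.subset_diff[OF _ True, of "live_arcs u"] Collect_subset Collect_mem_eq add.commute)
    also have "\<dots> \<approx> (\<Sum>e\<in>live_arcs u. ed e * gh e) + 0"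
    proof (rule cong_add[OF cong_refl])
      show "(\<Sum>e\<in>out_arcs E u - live_arcs u. ed e * gh e) \<approx> 0"
        unfolding cong_zero by (intro J_sum dead_arc) auto
    qed
    finally show ?thesis by simp
  next
    case False
    then have "u \<in> breaking_vertices E (path_H E p)"
      using u ne fin unfolding breaking_vertices_def infinite_emitter_def mem_Collect_eq
      by (intro conjI) simp_all
    from breaking_in[OF this] show ?thesis by (simp add: cong_def breaking_elem_def)
  qed
qed

text \<open>
  If \<open>q = \<gamma>\<^sup>\<infinity>\<close>, then \<open>\<gamma>\<close> is a power of a rotation of the exclusive cycle \<open>c\<close>, and \<open>c \<equiv> v\<close> passes to
  rotations and powers.
\<close>
lemma period_absorbed:
  assumes q: "q \<in> tail_class E p" and per: "q = \<gamma> @- q" "\<gamma> \<noteq> []"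
    and ex: "\<exists>v c. exclusive_cycle_at E v c \<and> ends_in_cycle p c"
  shows "mon (map Edge \<gamma> @ [Vertex (tail E (shd q))]) \<approx> mon [Vertex (tail E (shd q))]"
proof -
  obtain v c where c: "exclusive_cycle_at E v c" "ends_in_cycle p c" "cycle_minus_vertex v c \<in> J"
    using cycle_in[OF ex] by blast
  then have cyc: "awalk v c v" "c \<noteq> []" "distinct c"
    by (auto simp: exclusive_cycle_at_def cycle_at_def distinct_map)
  have "mon (map Edge c) \<approx> mon [Vertex v]"
    using c(3) by (simp add: cong_def cycle_minus_vertex_def prod_list_ed)
  note rot = rotate_closed[OF cyc(1,2) this]
  obtain n where n: "q = Stream.cycle (rotate n c)"
    using periodic_is_rotation[OF q fixpoint_sdrop[OF per(1)] _ c(2) cyc(2)] per(2) by auto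
  let ?d = "rotate n c"
  obtain w where w: "awalk w ?d w" "mon (map Edge ?d) \<approx> mon [Vertex w]" using rot by blast
  have "?d \<noteq> []" using cyc(2) by simp
  then have "tail E (shd q) = w" using w(1) n by (cases ?d) (auto simp: awalk_Cons_iff)
  moreover obtain m where "\<gamma> = concat (replicate m ?d)"
    using period_of_cycle[of ?d \<gamma>] per(1) n cyc by auto
  ultimately show ?thesis using power_closed[OF w] by simp
qed

text \<open>
  With infinitely many paths from \<open>u\<close> there is one on which the elements of \<open>A\<close> even act injectively.
  Otherwise every path from \<open>u\<close> will do: two elements of \<open>A\<close> that act equally on \<open>q\<close> differ by a
  period of \<open>q\<close>, and a periodic \<open>q\<close> then runs around an exclusive cycle, so that the period is
  congruent to \<open>u\<close>.
\<close>
lemma separating_path: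
  assumes u: "u \<in> verts E - path_H E p" and A: "finite A" "\<And>\<alpha>. \<alpha> \<in> A \<Longrightarrow> \<exists>a. awalk a \<alpha> u"
  obtains q where "q \<in> paths_from u"
    and "\<And>\<alpha> \<beta>. \<alpha> \<in> A \<Longrightarrow> \<beta> \<in> A \<Longrightarrow> \<alpha> @- q = \<beta> @- q \<Longrightarrow>
      mon (map Edge \<alpha> @ [Vertex u]) \<approx> mon (map Edge \<beta> @ [Vertex u])"
proof (cases "finite (paths_from u)")
  case False
  then obtain q where "q \<in> paths_from u" "inj_on (\<lambda>\<alpha>. \<alpha> @- q) A"
    using infinite_separates A(1) by blast
  then show ?thesis by (intro that[of q]) (auto dest: inj_onD)
next
  case True
  obtain q where q: "q \<in> paths_from u" using u paths_from_nonempty by blast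
  then have qc: "q \<in> tail_class E p" "tail E (shd q) = u" by (auto simp: paths_from_def)
  have *: "mon (map Edge \<alpha> @ [Vertex u]) \<approx> mon (map Edge \<beta> @ [Vertex u])"
    if \<alpha>: "\<alpha> \<in> A" and eq: "\<alpha> @- q = \<beta> @- q" and le: "length \<alpha> \<le> length \<beta>" for \<alpha> \<beta>
  proof (cases "\<alpha> = \<beta>")
    case False
    obtain \<gamma> where \<gamma>: "\<beta> = \<alpha> @ \<gamma>" "\<gamma> \<noteq> []" "q = \<gamma> @- q" using shift_eq_shift[OF eq False le] .
    have per: "sdrop (length \<gamma>) q = q" "length \<gamma> > 0" using fixpoint_sdrop[OF \<gamma>(3)] \<gamma>(2) by auto
    have "no_exit q" using finite_paths_no_exit[OF True q per] .
    from no_exit_exclusive[OF qc(1) this per]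
    have "mon (map Edge \<gamma> @ [Vertex u]) \<approx> mon [Vertex u]"
      using period_absorbed[OF qc(1) \<gamma>(3,2)] qc(2) by simp
    moreover obtain a where "awalk a \<alpha> u" using A(2) \<alpha> by blast
    ultimately have "mon (map Edge \<alpha> @ (map Edge \<gamma> @ [Vertex u]) @ []) \<approx> mon (map Edge \<alpha> @ [Vertex u] @ [])"
      using awalk_gens by (intro cong_context) auto
    then show ?thesis using \<gamma>(1) by (simp add: cong_sym)
  qed simp
  show ?thesis
  proof (rule that[OF q])
    fix \<alpha> \<beta> assume "\<alpha> \<in> A" "\<beta> \<in> A" "\<alpha> @- q = \<beta> @- q"
    then show "mon (map Edge \<alpha> @ [Vertex u]) \<approx> mon (map Edge \<beta> @ [Vertex u])"
      using *[of \<alpha> \<beta>] *[of \<beta> \<alpha>] cong_sym by (metis nle_le)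
  qed
qed

lemma normal_words_0:
  assumes "w \<in> normal_words u 0"
  obtains \<alpha> a where "w = map Edge \<alpha> @ [Vertex u]" "awalk a \<alpha> u"
  using assms by (auto elim!: normal_wordsE simp: normal_word_def awalk_Nil_iff)

lemma normal_words_ghost:
  assumes "w \<in> normal_words u n" "w \<notin> normal_words u 0"
  obtains w' f where "w = w' @ [Ghost f]" "f \<in> arcs E" "tail E f = u" "set w' \<subseteq> generators E"
proof -
  obtain \<alpha> v \<beta> a where w: "w = normal_word \<alpha> v \<beta>" "awalk a \<alpha> v" "awalk u \<beta> v" "length \<beta> \<le> n"
    using assms(1) by (rule normal_wordsE)
  have "\<beta> \<noteq> []" using assms(2) w normal_wordsI[of a \<alpha> v u "[]" 0] by auto
  then obtain f \<beta>' where \<beta>: "\<beta> = f # \<beta>'" by (cases \<beta>) auto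
  then have f: "f \<in> arcs E" "tail E f = u" "awalk (head E f) \<beta>' v" using w by (auto simp: awalk_Cons_iff)
  show ?thesis
    using w(1) \<beta> f(1,2) normal_word_gens[OF w(2) f(3)]
    by (intro that[of "normal_word \<alpha> v \<beta>'" f]) (simp_all add: normal_word_def)
qed

definition prefixes :: "'v \<Rightarrow> ('v, 'e, 'k) free_elem \<Rightarrow> 'e list set" where
  "prefixes u y = {\<alpha>. map Edge \<alpha> @ [Vertex u] \<in> Poly_Mapping.keys y}"

lemma finite_prefixes: "finite (prefixes u y)"
proof -
  have "inj (\<lambda>\<alpha>. map Edge \<alpha> @ [Vertex u] :: ('v, 'e) generator list)"
    by (auto intro!: injI simp: inj_map_eq_map inj_def)
  from finite_vimageI[OF _ this, of "Poly_Mapping.keys y"] show ?thesis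
    by (simp add: prefixes_def vimage_def)
qed

lemma path_combination_in_J:
  assumes keys: "Poly_Mapping.keys y \<subseteq> normal_words u 0" and q: "q \<in> paths_from u"
    and sep: "\<And>\<alpha> \<beta>. \<alpha> \<in> prefixes u y \<Longrightarrow> \<beta> \<in> prefixes u y \<Longrightarrow> \<alpha> @- q = \<beta> @- q \<Longrightarrow>
      mon (map Edge \<alpha> @ [Vertex u]) \<approx> mon (map Edge \<beta> @ [Vertex u])"
    and zero: "free_action E y (Poly_Mapping.single q 1) = 0"
  shows "y \<in> J"
proof -
  have "\<exists>\<alpha> a. w = map Edge \<alpha> @ [Vertex u] \<and> awalk a \<alpha> u" if "w \<in> Poly_Mapping.keys y" for w
  proof -
    from keys that have "w \<in> normal_words u 0" by (rule subsetD)
    then show ?thesis by (rule normal_words_0) blast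
  qed
  then obtain \<eta> where \<eta>: "\<And>w. w \<in> Poly_Mapping.keys y \<Longrightarrow> w = map Edge (\<eta> w) @ [Vertex u] \<and> (\<exists>a. awalk a (\<eta> w) u)"
    by metis
  show ?thesis
  proof (rule coefficients_vanish[of _ _ "\<lambda>w. \<eta> w @- q", OF _ _ zero])
    fix w assume "w \<in> Poly_Mapping.keys y"
    then show "word_action E w (Poly_Mapping.single q (1::'k)) = Poly_Mapping.single (\<eta> w @- q) 1"
      using \<eta> word_action_path[OF _ q] by metis
  next
    fix w w' assume "w \<in> Poly_Mapping.keys y" "w' \<in> Poly_Mapping.keys y" "\<eta> w @- q = \<eta> w' @- q"
    then show "mon w \<approx> mon w'"
      using \<eta>[of w] \<eta>[of w'] sep[of "\<eta> w" "\<eta> w'"] unfolding prefixes_def by (metis mem_Collect_eq)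
  qed
qed

lemma normal_at_dead_vertex:
  assumes keys: "Poly_Mapping.keys y \<subseteq> normal_words u n" and y: "y \<in> acarrier (free_algebra E)"
    and u: "u \<notin> verts E - path_H E p"
  shows "y \<in> J"
proof (cases "u \<in> verts E")
  case True
  then have "vx u \<in> J" using u by (intro H_in) simp
  then have "y * vx u \<in> J" using y by (intro J_mult_left)
  with cong_sym[OF normal_mult_vertex[OF keys True]] show ?thesis by (rule cong_in)
next
  case False
  then have "Poly_Mapping.keys y = {}" using keys normal_words_vertex_in by blast
  then show ?thesis by simp
qed

text \<open>
  The core of the argument, by induction on the ghost length.  Right multiplication by an arc
  shortens the ghost parts, so it suffices to recover \<open>y\<close> from the products \<open>y e\<close> with finitely many
  arcs \<open>e\<close>.  At a vertex with infinitely many live arcs this works only after the ghost-free part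
  of \<open>y\<close> has been split off and shown to lie in \<open>J\<close>.
\<close>
lemma normal_annihilator:
  assumes "Poly_Mapping.keys y \<subseteq> normal_words u n" "y \<in> free_annihilator E p"
  shows "y \<in> J"
  using assms
proof (induction n arbitrary: y u)
  case 0
  show ?case
  proof (cases "u \<in> verts E - path_H E p")
    case False
    with 0(1) ann_carrier[OF 0(2)] show ?thesis by (rule normal_at_dead_vertex)
  next
    case True
    have paths: "\<exists>a. awalk a \<alpha> u" if "\<alpha> \<in> prefixes u y" for \<alpha>
    proof -
      have "map Edge \<alpha> @ [Vertex u] \<in> normal_words u 0" using that 0(1) by (auto simp: prefixes_def)
      then obtain \<alpha>' a where "map Edge \<alpha> @ [Vertex u] = (map Edge \<alpha>' @ [Vertex u] :: ('v, 'e) generator list)" "awalk a \<alpha>' u"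
        by (rule normal_words_0)
      then show ?thesis by (auto simp: inj_map_eq_map inj_def)
    qed
    show ?thesis
    proof (rule separating_path[OF True finite_prefixes paths])
      fix q
      assume q: "q \<in> paths_from u"
        and sep: "\<And>\<alpha> \<beta>. \<alpha> \<in> prefixes u y \<Longrightarrow> \<beta> \<in> prefixes u y \<Longrightarrow> \<alpha> @- q = \<beta> @- q \<Longrightarrow>
          mon (map Edge \<alpha> @ [Vertex u]) \<approx> mon (map Edge \<beta> @ [Vertex u])"
      show "y \<in> J" by (rule path_combination_in_J[OF 0(1) q sep annihilator_act[OF 0(2) q]])
    qed
  qed
next
  case (Suc n)
  have edge: "y * ed e \<in> J"
    if ky: "Poly_Mapping.keys y \<subseteq> normal_words u (Suc n)" and y: "y \<in> free_annihilator E p"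
      and out: "e \<in> out_arcs E u" for y e
  proof -
    have e: "e \<in> arcs E" "tail E e = u" using out by auto
    obtain z where z: "Poly_Mapping.keys z \<subseteq> normal_words (head E e) n" "y * ed e \<approx> z"
      using normal_edge[OF ky e] by (elim exE conjE)
    have "y * ed e \<in> free_annihilator E p" using fc_gen(2)[OF e(1)] y by (rule ann_mult_right)
    then have "z \<in> free_annihilator E p" by (rule cong_annihilator[OF z(2)])
    from Suc.IH[OF z(1) this] show ?thesis by (rule cong_in[OF z(2)])
  qed
  have edges: "y * (\<Sum>e\<in>S. ed e * gh e) \<in> J"
    if ky: "Poly_Mapping.keys y \<subseteq> normal_words u (Suc n)" and y: "y \<in> free_annihilator E p"
      and S: "S \<subseteq> out_arcs E u" for y S
    unfolding sum_distrib_left mult.assoc[symmetric]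
  proof (rule J_sum)
    fix e assume "e \<in> S"
    then have e: "e \<in> out_arcs E u" using S by (rule subsetD[rotated])
    then have "gh e \<in> acarrier (free_algebra E)" by (intro fc_gen(3)) simp
    then show "y * ed e * gh e \<in> J" using edge[OF ky y e] by (rule J_mult_right)
  qed
  note y = Suc.prems
  have live: "live_arcs u \<subseteq> out_arcs E u" by blast
  consider "u \<notin> verts E - path_H E p" | "u \<in> verts E - path_H E p" "finite (live_arcs u)"
    | "u \<in> verts E - path_H E p" "infinite (live_arcs u)" by blast
  then show ?case
  proof cases
    case 1
    with y(1) ann_carrier[OF y(2)] show ?thesis by (rule normal_at_dead_vertex)
  next
    case 2
    have u: "u \<in> verts E" using 2(1) by simp
    have "y \<approx> y * vx u" by (rule cong_sym[OF normal_mult_vertex[OF y(1) u]])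
    moreover have "y * vx u \<approx> y * (\<Sum>e\<in>live_arcs u. ed e * gh e)"
      using live_vertex_sum[OF 2] ann_carrier[OF y(2)] by (rule cong_mult_left)
    ultimately have "y \<approx> y * (\<Sum>e\<in>live_arcs u. ed e * gh e)" by (rule cong_trans)
    moreover have "y * (\<Sum>e\<in>live_arcs u. ed e * gh e) \<in> J" by (rule edges[OF y live])
    ultimately show ?thesis by (rule cong_in)
  next
    case 3
    define y0 where "y0 = part (\<lambda>w. w \<in> normal_words u 0) y"
    define y1 where "y1 = part (\<lambda>w. w \<notin> normal_words u 0) y"
    have y01: "y = y0 + y1" unfolding y0_def y1_def by (rule part_add[symmetric])
    have k0: "Poly_Mapping.keys y0 \<subseteq> normal_words u 0" by (auto simp: y0_def keys_part)
    have k1: "Poly_Mapping.keys y1 \<subseteq> normal_words u (Suc n) - normal_words u 0"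
      using y(1) by (auto simp: y1_def keys_part)
    \<comment> \<open>the arcs that begin some \<open>\<beta>\<close>; a path starting with another arc is killed by \<open>y1\<close>\<close>
    define S where "S = {f \<in> out_arcs E u. Ghost f \<in> last ` Poly_Mapping.keys y1}"
    have "finite (Ghost -` last ` Poly_Mapping.keys y1 :: 'e set)"
      by (intro finite_vimageI) (auto intro: injI)
    then have finS: "finite S" by (rule rev_finite_subset) (auto simp: S_def)
    have ghost: "\<exists>w' f. w = w' @ [Ghost f] \<and> f \<in> S \<and> set w' \<subseteq> generators E" if "w \<in> Poly_Mapping.keys y1" for w
    proof -
      have "w \<in> normal_words u (Suc n)" "w \<notin> normal_words u 0" using k1 that by auto
      then obtain w' f where "w = w' @ [Ghost f]" "f \<in> arcs E" "tail E f = u" "set w' \<subseteq> generators E"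
        by (rule normal_words_ghost)
      then show ?thesis using that by (auto simp: S_def image_iff intro!: exI[of _ w'] bexI[of _ w])
    qed
    let ?Q = "{q \<in> paths_from u. shd q \<notin> S}"
    have "infinite (live_arcs u - S)" using 3(2) finS by simp
    moreover have "live_arcs u - S \<subseteq> shd ` ?Q"
    proof
      fix e assume e: "e \<in> live_arcs u - S"
      then obtain q where "e ## q \<in> paths_from u" using paths_from_SCons[of e] by auto
      then show "e \<in> shd ` ?Q" using e by (intro image_eqI[of _ _ "e ## q"]) auto
    qed
    ultimately have "infinite ?Q" by (meson finite_imageI finite_subset)
    then obtain q where q: "q \<in> paths_from u" "shd q \<notin> S" "inj_on (\<lambda>\<alpha>. \<alpha> @- q) (prefixes u y0)"
      using infinite_separates[OF _ finite_prefixes] by blast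
    have "word_action E w (Poly_Mapping.single q (1::'k)) = 0" if w: "w \<in> Poly_Mapping.keys y1" for w
    proof -
      obtain w' f where "w = w' @ [Ghost f]" "f \<in> S" using ghost[OF w] by blast
      moreover then have "shd q \<noteq> f" using q(2) by blast
      ultimately show ?thesis by (simp add: wa_append)
    qed
    then have "free_action E y1 (Poly_Mapping.single q 1) = 0"
      unfolding free_action_def linear_extension_def by simp
    then have "free_action E y0 (Poly_Mapping.single q 1) = 0"
      using annihilator_act[OF y(2) q(1)] by (simp add: y01 fa_add)
    then have "y0 \<in> J" using q by (intro path_combination_in_J[OF k0 q(1)]) (auto dest: inj_onD)
    then have "y1 \<in> free_annihilator E p"
      using ann_diff[OF y(2), of y0] J_annihilates by (auto simp: y01)
    then have "y1 * (\<Sum>e\<in>S. ed e * gh e) \<in> J"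
      using k1 by (intro edges) (auto simp: S_def)
    \<comment> \<open>\<open>f\<^sup>* (\<Sum> e e\<^sup>*) = f\<^sup>*\<close> for each \<open>f\<close> in \<open>S\<close>\<close>
    moreover have "y1 * 1 \<approx> y1 * (\<Sum>e\<in>S. ed e * gh e)"
    proof (rule cong_mult_expand)
      fix w assume "w \<in> Poly_Mapping.keys y1"
      then obtain w' f where w: "w = w' @ [Ghost f]" "f \<in> S" "set w' \<subseteq> generators E" using ghost by blast
      have f: "f \<in> arcs E" using w(2) by (auto simp: S_def)
      have one: "mon w * (ed e * gh e) \<approx> (if e = f then mon w else 0)" if "e \<in> S" for e
      proof -
        have e: "e \<in> arcs E" using that by (auto simp: S_def)
        have eq: "mon w * (ed e * gh e) = (mon (w' @ [Ghost f, Edge e] @ [Ghost e]) :: ('v, 'e, 'k) free_elem)"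
          by (simp add: mult_single plus_list_def w(1))
        show ?thesis
        proof (cases "e = f")
          case True
          have "mon (w' @ [Ghost f, Edge e] @ [Ghost e]) \<approx> mon (w' @ [Vertex (head E f)] @ [Ghost f])"
            unfolding True using w(3) f by (intro cong_context rel_mon) auto
          also have "\<dots> \<approx> mon (w' @ [Ghost f] @ [])"
            using cong_context[OF rel_mon(5)[OF f] w(3), of "[]"] by simp
          finally have "mon (w' @ [Ghost f, Edge e] @ [Ghost e]) \<approx> mon w" using w(1) by simp
          then show ?thesis unfolding eq by (simp add: True)
        next
          case False
          have "mon (w' @ [Ghost f, Edge e] @ [Ghost e]) \<in> J"
            using w(3) f e False by (intro J_context rel_mon) auto
          then show ?thesis using eq False by (simp add: cong_zero)
        qed
      qed
      have "(\<Sum>e\<in>S. mon w * (ed e * gh e)) \<approx> (\<Sum>e\<in>S. if e = f then mon w else 0)"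
        by (rule cong_sum) (rule one)
      also have "(\<Sum>e\<in>S. if e = f then mon w else 0) = (mon w :: ('v, 'e, 'k) free_elem)"
        using finS w(2) by simp
      finally have "(\<Sum>e\<in>S. mon w * (ed e * gh e)) \<approx> mon w" .
      then show "mon w * 1 \<approx> mon w * (\<Sum>e\<in>S. ed e * gh e)"
        unfolding sum_distrib_left mult_1_right by (rule cong_sym)
    qed
    ultimately have "y1 \<in> J" using cong_in by fastforce
    with \<open>y0 \<in> J\<close> show ?thesis unfolding y01 by (intro J_add)
  qed
qed

text \<open>
  An annihilating element splits, up to congruence, into finitely many annihilating ones, one for each
  end vertex of its normal words.
\<close>
theorem annihilator_subset: "free_annihilator E p \<subseteq> J"
proof
  fix x :: "('v, 'e, 'k) free_elem" assume x: "x \<in> free_annihilator E p"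
  obtain n y where y: "Poly_Mapping.keys y \<subseteq> (\<Union>u. normal_words u n)" "x \<approx> y"
    using normalizes[OF ann_carrier[OF x]] by (elim exE conjE)
  have y_ann: "y \<in> free_annihilator E p" using cong_annihilator[OF y(2) x] .
  obtain \<rho> where \<rho>: "\<And>w. w \<in> Poly_Mapping.keys y \<Longrightarrow> w \<in> normal_words (\<rho> w) n"
  proof -
    have "\<forall>w\<in>Poly_Mapping.keys y. \<exists>u. w \<in> normal_words u n"
      using subsetD[OF y(1)] by (intro ballI) (simp only: UN_iff bex_UNIV)
    from bchoice[OF this] show ?thesis by (elim exE) (rule that, blast)
  qed
  have "part (\<lambda>w. \<rho> w = u) y \<in> J" if "u \<in> \<rho> ` Poly_Mapping.keys y" for u
  proof (rule normal_annihilator)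
    show "Poly_Mapping.keys (part (\<lambda>w. \<rho> w = u) y) \<subseteq> normal_words u n"
      using \<rho> by (auto simp: keys_part)
    have "u \<in> verts E" using that \<rho> normal_words_vertex_in by blast
    moreover from this have "y * vx u \<in> free_annihilator E p"
      using y_ann fc_gen(1) by (intro ann_mult_right)
    ultimately show "part (\<lambda>w. \<rho> w = u) y \<in> free_annihilator E p"
      using cong_annihilator[OF cong_sym[OF normal_part[OF \<rho>]]] by blast
  qed
  then have "y \<in> J" by (subst sum_part[of \<rho> y, symmetric]) (rule J_sum)
  then show "x \<in> J" by (rule cong_in[OF y(2)])
qed

end

section \<open>Passage to the Leavitt path algebra\<close>

lemma ideal_gen_least: "is_ideal A I \<Longrightarrow> S \<subseteq> I \<Longrightarrow> ideal_gen A S \<subseteq> I"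
  by (auto simp: ideal_gen_def)

lemma ideal_gen_contains: "S \<subseteq> ideal_gen A S"
  by (auto simp: ideal_gen_def)

lemma ideal_gen_ideal:
  assumes "is_ideal A I" "S \<subseteq> I"
  shows "is_ideal A (ideal_gen A S)"
  using assms unfolding ideal_gen_def by (auto simp: is_ideal_def)

lemma annihilator_lpa:
  assumes "wf_digraph E"
  shows "annihilator (lpa E) (lpa_action E) (chen_module E p :: ('e, 'k::field) path_vec set) =
    lpa_class E ` (free_annihilator E p :: ('v, 'e, 'k) free_elem set)"
proof -
  have act: "lpa_action E (lpa_class E x) m = free_action E x m" if "m \<in> chen_module E p"
    for x :: "('v, 'e, 'k) free_elem" and m using assms that by (rule lpa_action_class)
  show ?thesis
    unfolding annihilator_def free_annihilator_def lpa_ops(1)[OF assms] using act by (auto simp: image_iff)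
qed

lemma class_in_annihilator:
  fixes x :: "('v, 'e, 'k::field) free_elem"
  assumes wf: "wf_digraph E" and x: "x \<in> acarrier (free_algebra E)"
    and kill: "\<And>q. q \<in> tail_class E p \<Longrightarrow> free_action E x (Poly_Mapping.single q (1::'k)) = 0"
  shows "x \<in> free_annihilator E p"
proof -
  have "free_action E x m = 0" if m: "m \<in> chen_module E p" for m :: "('e, 'k) path_vec"
  proof -
    have "free_action E x (Poly_Mapping.single q k) = 0" if "q \<in> tail_class E p" for q k
      using kill[OF that] fa_scale_right[of E x k "Poly_Mapping.single q 1"] by simp
    then have "(\<Sum>q\<in>Poly_Mapping.keys m. free_action E x (Poly_Mapping.single q (Poly_Mapping.lookup m q))) = 0"
      using m by (intro sum.neutral) (auto simp: chen_module_def)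
    then show ?thesis by (subst poly_mapping_expand[of m]) (simp only: fa_sum_right)
  qed
  with x show ?thesis by (simp add: free_annihilator_def)
qed

lemma annihilator_ideal_lpa:
  assumes wf: "wf_digraph E"
  shows "is_ideal (lpa E) (lpa_class E ` (free_annihilator E p :: ('v, 'e, 'k::field) free_elem set))"
proof -
  let ?K = "free_annihilator E p :: ('v, 'e, 'k) free_elem set"
  note ops = lpa_ops[OF wf]
  have K: "is_ideal (free_algebra E) ?K"
    by (rule kills_ideal)
  then have sub: "?K \<subseteq> acarrier (free_algebra E)"
    by (simp add: is_ideal_def)
  show ?thesis
    unfolding is_ideal_def
  proof (intro conjI ballI allI)
    show "lpa_class E ` ?K \<subseteq> acarrier (lpa E)"
      using sub by (auto simp: ops(1))
    show "azero (lpa E) \<in> lpa_class E ` ?K"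
      using K by (auto simp: ops(2) is_ideal_def)
  next
    fix X Y :: "('v, 'e, 'k) lpa_elem"
    assume "X \<in> lpa_class E ` ?K"
      "Y \<in> lpa_class E ` ?K"
    then show "aadd (lpa E) X Y \<in> lpa_class E ` ?K"
      using K by (auto simp: ops(3) is_ideal_def)
  next
    fix k and X :: "('v, 'e, 'k) lpa_elem"
    assume "X \<in> lpa_class E ` ?K"
    then show "ascale (lpa E) k X \<in> lpa_class E ` ?K"
      using K by (auto simp: ops(4) is_ideal_def)
  next
    fix A X :: "('v, 'e, 'k) lpa_elem"
    assume "A \<in> acarrier (lpa E)" "X \<in> lpa_class E ` ?K"
    then obtain a x where ax: "A = lpa_class E a" "a \<in> acarrier (free_algebra E)"
      "X = lpa_class E x" "x \<in> free_annihilator E p" by (auto simp: ops(1))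
    then have "x \<in> acarrier (free_algebra E)" using sub by blast
    then show "amult (lpa E) A X \<in> lpa_class E ` ?K"
      "amult (lpa E) X A \<in> lpa_class E ` ?K"
      using K ax by (auto simp: ops(5) is_ideal_def)
  qed
qed

lemma preimage_ideal:
  fixes I :: "('v, 'e, 'k::field) lpa_elem set"
  assumes wf: "wf_digraph E" and I: "is_ideal (lpa E) I"
  shows "leavitt_ideal E {x \<in> acarrier (free_algebra E). lpa_class E x \<in> I}"
proof -
  interpret wf_digraph E by fact
  note ops = lpa_ops[OF wf]
  have add: "lpa_class E (x + y) \<in> I" if "lpa_class E x \<in> I" "lpa_class E y \<in> I"
    for x y :: "('v, 'e, 'k) free_elem"
    using I that ops(3)[of x y] unfolding is_ideal_def by metis
  have scale: "lpa_class E (scale k x) \<in> I" if "lpa_class E x \<in> I" for k and x :: "('v, 'e, 'k) free_elem"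
    using I that ops(4)[of k x] unfolding is_ideal_def by metis
  have mult: "lpa_class E (a * x) \<in> I" "lpa_class E (x * a) \<in> I"
    if "lpa_class E x \<in> I" "x \<in> acarrier (free_algebra E)" "a \<in> acarrier (free_algebra E)"
    for a x :: "('v, 'e, 'k) free_elem"
  proof -
    have "lpa_class E a \<in> acarrier (lpa E)" using that(3) by (simp add: ops(1))
    then have "amult (lpa E) (lpa_class E a) (lpa_class E x) \<in> I" "amult (lpa E) (lpa_class E x) (lpa_class E a) \<in> I"
      using I that(1) unfolding is_ideal_def by blast+
    then show "lpa_class E (a * x) \<in> I" "lpa_class E (x * a) \<in> I"
      by (simp_all only: ops(5)[OF that(3,2)] ops(5)[OF that(2,3)])
  qed
  have zero: "lpa_class E 0 \<in> I" using I ops(2) unfolding is_ideal_def by metis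
  show ?thesis
  proof unfold_locales
    show "is_ideal (free_algebra E) {x \<in> acarrier (free_algebra E). lpa_class E x \<in> I}"
      using add scale mult zero by (auto simp: is_ideal_def fc_zero fc_add fc_scale fc_mult)
    show "relators E \<subseteq> {x \<in> acarrier (free_algebra E). lpa_class E x \<in> I}"
    proof
      fix x :: "('v, 'e, 'k) free_elem" assume x: "x \<in> relators E"
      then have "x \<in> relation_ideal E" unfolding relation_ideal_def using ideal_gen_contains by (rule subsetD[rotated])
      then have "lpa_class E x = lpa_class E 0" using lpa_class_eq_iff[OF wf, of x 0] by simp
      then show "x \<in> {x \<in> acarrier (free_algebra E). lpa_class E x \<in> I}"
        using zero relators_carrier[OF wf] x by auto
    qed
  qed
qed

context path_class
begin

lemma vertex_annihilates:
  assumes "h \<in> path_H E p"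
  shows "(vx h :: ('v, 'e, 'k::field) free_elem) \<in> free_annihilator E p"
proof (rule class_in_annihilator[OF wf_digraph])
  show "vx h \<in> acarrier (free_algebra E)" using assms by (intro fc_gen) (simp add: path_H_def)
  fix q assume "q \<in> tail_class E p"
  then have "h \<noteq> tail E (shd q)" using class_not_in_H[of q 0] assms by auto
  then show "free_action E (vx h) (Poly_Mapping.single q (1::'k)) = 0" by simp
qed

lemma breaking_annihilates:
  assumes "u \<in> breaking_vertices E (path_H E p)"
  shows "(breaking_elem E (path_H E p) u :: ('v, 'e, 'k::field) free_elem) \<in> free_annihilator E p"
proof (rule class_in_annihilator[OF wf_digraph])
  let ?F = "{e. e \<in> out_arcs E u \<and> head E e \<notin> path_H E p}"
  have u: "u \<in> verts E" and fin: "finite ?F" using assms by (auto simp: breaking_vertices_def)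
  show "breaking_elem E (path_H E p) u \<in> acarrier (free_algebra E)"
    unfolding breaking_elem_def by (intro fc_diff fc_sum fc_mult fc_gen) (use u in auto)
  fix q assume q: "q \<in> tail_class E p"
  have arc: "shd q \<in> arcs E" "head E (shd q) = tail E (shd (stl q))" "head E (shd q) \<notin> path_H E p"
    using class_arcs[OF q, of 0] class_not_in_H[OF q, of 1] by auto
  have "free_action E (ed e * gh e) (Poly_Mapping.single q (1::'k)) =
      (if e = shd q then Poly_Mapping.single q 1 else 0)" for e
    using arc by (auto simp: fa_mult)
  then have "(\<Sum>e\<in>?F. free_action E (ed e * gh e) (Poly_Mapping.single q (1::'k))) =
      (\<Sum>e\<in>?F. if e = shd q then Poly_Mapping.single q 1 else 0)"
    by (simp only:)
  also have "\<dots> = (if shd q \<in> ?F then Poly_Mapping.single q 1 else 0)" using fin by (rule sum.delta)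
  finally show "free_action E (breaking_elem E (path_H E p) u) (Poly_Mapping.single q (1::'k)) = 0"
    using arc by (auto simp: breaking_elem_def fa_diff fa_sum_left)
qed

lemma cycle_annihilates:
  assumes c: "exclusive_cycle_at E v c" "ends_in_cycle p c"
  shows "(cycle_minus_vertex v c :: ('v, 'e, 'k::field) free_elem) \<in> free_annihilator E p"
proof (rule class_in_annihilator[OF wf_digraph])
  have cyc: "awalk v c v" "c \<noteq> []" using c(1) by (auto simp: exclusive_cycle_at_def cycle_at_def)
  show "cycle_minus_vertex v c \<in> acarrier (free_algebra E)"
    unfolding cycle_minus_vertex_def prod_list_ed
  proof (rule fc_diff)
    show "mon (map Edge c) \<in> acarrier (free_algebra E)"
      using cyc by (auto simp: free_algebra_def generators_def awalk_def)
    show "vx v \<in> acarrier (free_algebra E)" using cyc(1) by (intro fc_gen awalk_hd_in_verts)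
  qed
  fix q assume q: "q \<in> tail_class E p"
  obtain e c' where ec: "c = c' @ [e]" using cyc(2) by (cases c rule: rev_cases) auto
  show "free_action E (cycle_minus_vertex v c) (Poly_Mapping.single q (1::'k)) = 0"
  proof (cases "tail E (shd q) = v")
    case True
    then have qv: "q \<in> paths_from v" using q by (simp add: paths_from_def)
    have "c @- q = q"
      unfolding exclusive_paths_from[OF c qv] by (rule cycle_decomp[OF cyc(2), symmetric])
    moreover have "word_action E (map Edge c @ [Vertex v]) (Poly_Mapping.single q (1::'k)) = Poly_Mapping.single (c @- q) 1"
      using cyc(1) qv by (rule word_action_path)
    ultimately show ?thesis
      using True by (simp add: cycle_minus_vertex_def prod_list_ed fa_diff wa_append)
  next
    case False
    moreover have "head E e = v" using cyc(1) ec by (auto simp: awalk_append_iff awalk_Cons_iff awalk_Nil_iff)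
    ultimately show ?thesis
      by (simp add: cycle_minus_vertex_def prod_list_ed fa_diff fa_mult ec)
  qed
qed

text \<open>
  Both parts of the statement at once: the set \<open>S\<close> need only generate an ideal that contains the
  relevant elements.
\<close>
lemma annihilator_eq_ideal_gen:
  fixes S :: "('v, 'e, 'k::field) lpa_elem set"
  defines "K \<equiv> free_annihilator E p :: ('v, 'e, 'k) free_elem set"
  assumes S: "S \<subseteq> lpa_class E ` K"
    and H: "\<And>h. h \<in> path_H E p \<Longrightarrow> lpa_class E (vx h) \<in> ideal_gen (lpa E) S"
    and B: "\<And>u. u \<in> breaking_vertices E (path_H E p) \<Longrightarrow>
      lpa_class E (breaking_elem E (path_H E p) u) \<in> ideal_gen (lpa E) S"
    and cyc: "\<exists>v c. exclusive_cycle_at E v c \<and> ends_in_cycle p c \<Longrightarrow>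
      \<exists>v c. exclusive_cycle_at E v c \<and> ends_in_cycle p c \<and>
        lpa_class E (cycle_minus_vertex v c) \<in> ideal_gen (lpa E) S"
  shows "lpa_class E ` K = ideal_gen (lpa E) S"
proof
  let ?I = "ideal_gen (lpa E) S"
  let ?J = "{x \<in> acarrier (free_algebra E). lpa_class E x \<in> ?I} :: ('v, 'e, 'k) free_elem set"
  have KI: "is_ideal (lpa E) (lpa_class E ` K)"
    unfolding K_def by (rule annihilator_ideal_lpa[OF wf_digraph])
  show sub: "?I \<subseteq> lpa_class E ` K" using KI S by (rule ideal_gen_least)
  have carrier: "x \<in> acarrier (free_algebra E)" if "x \<in> K" for x
    using that by (simp add: K_def free_annihilator_def)
  interpret J: leavitt_ideal E ?J
    by (rule preimage_ideal[OF wf_digraph ideal_gen_ideal[OF KI S]])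
  have "chen_ideal E p ?J"
  proof unfold_locales
    show "vx v \<in> ?J" if "v \<in> path_H E p" for v
      using H[OF that] carrier vertex_annihilates[OF that] by (simp add: K_def)
    show "breaking_elem E (path_H E p) u \<in> ?J" if "u \<in> breaking_vertices E (path_H E p)" for u
      using B[OF that] carrier breaking_annihilates[OF that] by (simp add: K_def)
    show "\<exists>v c. exclusive_cycle_at E v c \<and> ends_in_cycle p c \<and> cycle_minus_vertex v c \<in> ?J"
      if ex: "\<exists>v c. exclusive_cycle_at E v c \<and> ends_in_cycle p c"
    proof -
      obtain v c where vc: "exclusive_cycle_at E v c" "ends_in_cycle p c"
        "lpa_class E (cycle_minus_vertex v c) \<in> ?I" using cyc[OF ex] by (elim exE conjE)
      have "cycle_minus_vertex v c \<in> K" unfolding K_def using vc(1,2) by (rule cycle_annihilates)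
      then have "cycle_minus_vertex v c \<in> ?J" using vc(3) carrier by simp
      with vc(1,2) show ?thesis by (intro exI conjI)
    qed
    show "?J \<subseteq> free_annihilator E p"
    proof
      fix x :: "('v, 'e, 'k) free_elem" assume "x \<in> ?J"
      then have "lpa_class E x \<in> lpa_class E ` K" using sub by (intro subsetD[OF sub]) simp
      then obtain y where y: "lpa_class E x = lpa_class E y" "y \<in> K" by (rule imageE)
      have "x - y \<in> relation_ideal E" using lpa_class_eq_iff[OF wf_digraph, of x y] y(1) by simp
      moreover have "relation_ideal E \<subseteq> K"
        unfolding relation_ideal_def K_def
        by (rule ideal_gen_least[OF kills_ideal relators_kills[OF wf_digraph]])
      ultimately have "x - y \<in> K" by (rule subsetD[rotated])
      then have "(x - y) + y \<in> K"
        using y(2) unfolding K_def by (rule leavitt_ideal.J_add[OF annihilator_leavitt_ideal])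
      then show "x \<in> free_annihilator E p" by (simp add: K_def)
    qed
  qed
  then have "free_annihilator E p \<subseteq> ?J" by (rule chen_ideal.annihilator_subset)
  then have "x \<in> K \<Longrightarrow> x \<in> ?J" for x unfolding K_def by (rule subsetD)
  then show "lpa_class E ` K \<subseteq> ?I" by (intro image_subsetI) simp
qed

end

theorem lemma3p2:
  fixes E :: "('v, 'e) pre_digraph" and p :: "'e stream"
  assumes "wf_digraph E" and "infinite_path E p"
  defines "H \<equiv> path_H E p"
  defines "Ann \<equiv> annihilator (lpa E) (lpa_action E)
                   (chen_module E p :: ('e, 'k::field) path_vec set)"
  shows "(\<not> (\<exists>v c. exclusive_cycle_at E v c \<and> ends_in_cycle p c) \<longrightarrow>
            Ann = ideal_HS E H (breaking_vertices E H)) \<and>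
         (\<forall>v c. exclusive_cycle_at E v c \<and> ends_in_cycle p c \<longrightarrow>
            Ann = ideal_gen (lpa E)
                    (ideal_HS E H (breaking_vertices E H)
                       \<union> {lpa_class E (cycle_minus_vertex v c)}))"
proof -
  interpret path_class E p
    by (rule path_class.intro[OF assms(1) path_class_axioms.intro[OF assms(2)]])
  let ?K = "free_annihilator E p :: ('v, 'e, 'k) free_elem set"
  let ?G = "(\<lambda>v. lpa_class E (vx v)) ` H \<union>
    (\<lambda>u. lpa_class E (breaking_elem E H u)) ` breaking_vertices E H :: ('v, 'e, 'k) lpa_elem set"
  have Ann: "Ann = lpa_class E ` ?K" unfolding Ann_def by (rule annihilator_lpa[OF assms(1)])
  have HS: "ideal_HS E H (breaking_vertices E H) = ideal_gen (lpa E) ?G" by (simp add: ideal_HS_def)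
  have G: "?G \<subseteq> lpa_class E ` ?K"
    unfolding H_def by (intro Un_least image_subsetI imageI vertex_annihilates breaking_annihilates)
  have I_sub: "ideal_gen (lpa E) ?G \<subseteq> lpa_class E ` ?K"
    using annihilator_ideal_lpa[OF assms(1)] G by (rule ideal_gen_least)
  show ?thesis
    unfolding Ann HS
  proof (intro conjI allI impI)
    assume no: "\<not> (\<exists>v c. exclusive_cycle_at E v c \<and> ends_in_cycle p c)"
    show "lpa_class E ` ?K = ideal_gen (lpa E) ?G"
    proof (rule annihilator_eq_ideal_gen[OF G])
      show "lpa_class E (vx h) \<in> ideal_gen (lpa E) ?G" if "h \<in> path_H E p" for h
        using that by (intro subsetD[OF ideal_gen_contains]) (auto simp: H_def)
      show "lpa_class E (breaking_elem E (path_H E p) u) \<in> ideal_gen (lpa E) ?G"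
        if "u \<in> breaking_vertices E (path_H E p)" for u
        using that by (intro subsetD[OF ideal_gen_contains]) (auto simp: H_def)
    qed (use no in blast)
  next
    fix v c assume vc: "exclusive_cycle_at E v c \<and> ends_in_cycle p c"
    let ?S = "ideal_gen (lpa E) ?G \<union> {lpa_class E (cycle_minus_vertex v c)}"
    have G_S: "X \<in> ideal_gen (lpa E) ?S" if "X \<in> ?G" for X
    proof (rule subsetD[OF ideal_gen_contains], rule UnI1)
      show "X \<in> ideal_gen (lpa E) ?G" using that by (rule subsetD[OF ideal_gen_contains])
    qed
    show "lpa_class E ` ?K = ideal_gen (lpa E) ?S"
    proof (rule annihilator_eq_ideal_gen)
      have "lpa_class E (cycle_minus_vertex v c) \<in> lpa_class E ` ?K"
        using vc by (intro imageI cycle_annihilates) auto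
      then show "?S \<subseteq> lpa_class E ` ?K" using I_sub by (intro Un_least) simp_all
      show "lpa_class E (vx h) \<in> ideal_gen (lpa E) ?S" if "h \<in> path_H E p" for h
        using that by (intro G_S) (auto simp: H_def)
      show "lpa_class E (breaking_elem E (path_H E p) u) \<in> ideal_gen (lpa E) ?S"
        if "u \<in> breaking_vertices E (path_H E p)" for u
        using that by (intro G_S) (auto simp: H_def)
      show "\<exists>v c. exclusive_cycle_at E v c \<and> ends_in_cycle p c \<and>
          lpa_class E (cycle_minus_vertex v c) \<in> ideal_gen (lpa E) ?S"
        using vc by (intro exI[of _ v] exI[of _ c] conjI subsetD[OF ideal_gen_contains] UnI2) simp_all
    qed
  qed
qed

end
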